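(* Let $M_1,M_2$ be matroids on the same ground set with $n$ elements, and let $H_k$ denote the number of pairs $(I_1,I_2)$, where $I_1$ is an independent set of $M_1$, $I_2$ is an independent set of $M_2$, $I_1\cap I_2=\emptyset$, and $I_1\cup I_2$ has exactly $k$ elements. Then for every integer $k$ with $0\leq k\leq n-2$, $$\frac{H_k}{\binom{n}{k}}\cdot \frac{H_{k+2}}{\binom{n}{k+2}}\leq \left(\frac{H_{k+1}}{\binom{n}{k+1}}\right)^2.$$
   Context: Matroids are finite matroids in the usual sense. Pairs $(I_1,I_2)$ are ordered, with $I_1$ independent in $M_1$ and $I_2$ independent in $M_2$. *)

theory Defs
  imports Complex_Main
begin

locale matroid =
  fixes carrier :: "'a set"
    and indep :: "'a set \<Rightarrow> bool"
  assumes finite_carrier: "finite carrier"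
    and indep_subset_carrier: "indep X \<Longrightarrow> X \<subseteq> carrier"
    and indep_empty: "indep {}"
    and indep_subset: "indep X \<Longrightarrow> Y \<subseteq> X \<Longrightarrow> indep Y"
    and augment: "indep X \<Longrightarrow> indep Y \<Longrightarrow> card X < card Y \<Longrightarrow>
      \<exists>x \<in> Y - X. indep (insert x X)"

definition disjoint_indep_pairs ::
    "('a set \<Rightarrow> bool) \<Rightarrow> ('a set \<Rightarrow> bool) \<Rightarrow> nat \<Rightarrow> ('a set \<times> 'a set) set" where
  "disjoint_indep_pairs indep1 indep2 k =
    {(I1, I2). indep1 I1 \<and> indep2 I2 \<and> I1 \<inter> I2 = {} \<and> card (I1 \<union> I2) = k}"

text \<open>For matroids on a common ground set the counted set is finite, being a subset of
  the pairs of subsets of the ground set, so that \<open>card\<close> is the true number of pairs.\<close>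

definition num_disjoint_indep_pairs ::
    "('a set \<Rightarrow> bool) \<Rightarrow> ('a set \<Rightarrow> bool) \<Rightarrow> nat \<Rightarrow> nat" where
  "num_disjoint_indep_pairs indep1 indep2 k = card (disjoint_indep_pairs indep1 indep2 k)"

end

theory Submission
  imports Defs "HOL-Analysis.Analysis" "HOL-Library.Multiset"
begin

text \<open>
  A matroid on \<open>N\<close> elements has the homogeneous polynomial
  \<open>g(w\<^sub>0, w) = (\<Sum>I indep. w\<^sub>0^|I| * (\<Prod>i\<notin>I. w\<^sub>i))\<close> of degree \<open>N\<close>. All its derivatives of degree 2 are
  hyperbolic quadratic forms: such a derivative only sees restrictions of nullity at most 2, where
  dependence of complements is a partition into parallel classes. A local-to-global argument then
  shows that the polarization of \<open>g\<close> satisfies the Alexandrov--Fenchel inequality: an eigenvalue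
  \<open>\<mu>\<close> of the normalized form satisfies \<open>\<mu> \<le> \<mu>\<^sup>2\<close>, and connectedness makes the eigenvalue 1 simple.

  Apply this to the direct sum of the two matroids, on two copies \<open>x, x'\<close> of each point, with
  \<open>N = 2n\<close>. Filling \<open>n\<close> of the slots with the directions \<open>e\<^sub>x + e\<^sub>x\<^sub>'\<close> forces the two independent sets
  to be disjoint; filling the other slots with \<open>k\<close> copies of \<open>e\<^sub>0\<close> and \<open>n - k\<close> copies of the all-ones
  direction yields \<open>k! (n - k)! 2^(n - k) H\<^sub>k\<close>, that is, \<open>n! 2^(n - k)\<close> times \<open>H\<^sub>k / (n choose k)\<close>. The
  three values with \<open>k\<close>, \<open>k + 1\<close> and \<open>k + 2\<close> copies are related by Alexandrov--Fenchel.
\<close>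

section \<open>Hyperbolic quadratic forms\<close>

definition bil :: "'v set \<Rightarrow> ('v \<Rightarrow> 'v \<Rightarrow> real) \<Rightarrow> ('v \<Rightarrow> real) \<Rightarrow> ('v \<Rightarrow> real) \<Rightarrow> real" where
  "bil V A f g = (\<Sum>u\<in>V. \<Sum>v\<in>V. A u v * f u * g v)"

text \<open>Reversed Cauchy--Schwarz against nonnegative vectors. For a symmetric matrix with
  nonnegative entries it says that there is at most one positive eigenvalue. As an inequality it
  passes to limits and covers the zero form.\<close>

definition hyperbolic :: "'v set \<Rightarrow> ('v \<Rightarrow> 'v \<Rightarrow> real) \<Rightarrow> bool" where
  "hyperbolic V A \<longleftrightarrow>
    (\<forall>f g. (\<forall>v\<in>V. 0 \<le> g v) \<longrightarrow> bil V A f f * bil V A g g \<le> (bil V A f g)\<^sup>2)"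

lemma bil_commute:
  assumes "\<And>u v. A u v = A v u"
  shows "bil V A f g = bil V A g f"
  unfolding bil_def by (subst sum.swap) (simp add: assms mult_ac)

lemma bil_rows: "bil V A f g = (\<Sum>u\<in>V. f u * (\<Sum>v\<in>V. A u v * g v))"
  unfolding bil_def by (simp add: sum_distrib_left mult_ac)

lemma bil_add_scale_left:
  "bil V A (\<lambda>v. f v + t * g v) h = bil V A f h + t * bil V A g h"
  unfolding bil_def by (simp add: sum_distrib_left sum.distrib algebra_simps)

lemma bil_square:
  assumes "\<And>u v. A u v = A v u"
  shows "bil V A (\<lambda>v. f v + t * g v) (\<lambda>v. f v + t * g v) =
    bil V A f f + 2 * t * bil V A f g + t\<^sup>2 * bil V A g g"
proof -
  have *: "bil V A h (\<lambda>v. f v + t * g v) = bil V A f h + t * bil V A g h" for h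
    by (simp add: bil_commute[OF assms, where f = h] bil_add_scale_left)
  have "bil V A g f = bil V A f g" by (rule bil_commute[OF assms])
  then show ?thesis
    by (simp add: bil_add_scale_left * power2_eq_square algebra_simps)
qed

lemma bil_scale: "bil V A (\<lambda>v. t * f v) (\<lambda>v. t * f v) = t\<^sup>2 * bil V A f f"
  unfolding bil_def by (simp add: sum_distrib_left power2_eq_square mult_ac)

lemma bil_nonneg:
  assumes "\<And>u v. 0 \<le> A u v" "\<And>v. v \<in> V \<Longrightarrow> 0 \<le> f v" "\<And>v. v \<in> V \<Longrightarrow> 0 \<le> g v"
  shows "0 \<le> bil V A f g"
  unfolding bil_def by (intro sum_nonneg mult_nonneg_nonneg assms)

text \<open>Shifting \<open>f\<close> by a multiple of \<open>g\<close> brings it into the kernel of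
  the functional, where the form is nonpositive; multiplying by \<open>bil V A g g \<ge> 0\<close>
  and completing the square gives the inequality. If \<open>g\<close> lies in the kernel, its own
  value is 0.\<close>

lemma hyperbolicI:
  assumes sym: "\<And>u v. A u v = A v u" and nonneg: "\<And>u v. 0 \<le> A u v"
    and ker: "\<And>f. (\<Sum>v\<in>V. a v * f v) = 0 \<Longrightarrow> bil V A f f \<le> 0"
  shows "hyperbolic V A"
  unfolding hyperbolic_def
proof (intro allI impI)
  fix f g :: "'a \<Rightarrow> real"
  assume g: "\<forall>v\<in>V. 0 \<le> g v"
  let ?B = "bil V A"
  let ?l = "\<lambda>f. \<Sum>v\<in>V. a v * f v"
  have gg: "0 \<le> ?B g g" using nonneg g by (intro bil_nonneg) auto
  show "?B f f * ?B g g \<le> (?B f g)\<^sup>2"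
  proof (cases "?l g = 0")
    case True
    then have "?B g g = 0" using ker[of g] gg by simp
    then show ?thesis by simp
  next
    case False
    define t where "t = - ?l f / ?l g"
    have "?l (\<lambda>v. f v + t * g v) = ?l f + t * ?l g"
      by (simp add: sum.distrib sum_distrib_left algebra_simps)
    also have "\<dots> = 0" using False by (simp add: t_def)
    finally have "?B f f + 2 * t * ?B f g + t\<^sup>2 * ?B g g \<le> 0"
      unfolding bil_square[OF sym, symmetric] by (rule ker)
    then have "(?B f f + 2 * t * ?B f g + t\<^sup>2 * ?B g g) * ?B g g \<le> 0"
      using gg by (simp add: mult_nonpos_nonneg)
    moreover have "0 \<le> (?B f g + t * ?B g g)\<^sup>2" by simp
    ultimately show ?thesis by (simp add: power2_eq_square algebra_simps)
  qed
qed

section \<open>The spectral argument on a hyperplane\<close>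

lemma linear_coeff_zero:
  fixes \<alpha> \<beta> :: real
  assumes "\<And>t. 0 \<le> 2 * t * \<alpha> + t\<^sup>2 * \<beta>"
  shows "\<alpha> = 0"
proof (rule ccontr)
  assume "\<alpha> \<noteq> 0"
  \<comment> \<open>With \<open>t = - \<alpha> / b\<close>, where \<open>b\<close> is larger than
    both 0 and \<open>\<beta>\<close>, the linear term outweighs the quadratic one.\<close>
  define b where "b = \<bar>\<beta>\<bar> + 1"
  have b: "b > 0" "\<beta> < b" by (auto simp: b_def)
  have "0 \<le> 2 * (- \<alpha> / b) * \<alpha> + (- \<alpha> / b)\<^sup>2 * \<beta>" by (rule assms)
  also have "\<dots> = (\<alpha>\<^sup>2 / b) * (\<beta> / b - 2)"
    using b by (simp add: field_simps power2_eq_square)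
  also have "\<dots> < 0"
    using b \<open>\<alpha> \<noteq> 0\<close> by (intro mult_pos_neg) (auto simp: field_simps)
  finally show False by simp
qed

lemma double_sum_nonneg_0:
  fixes h :: "'v \<Rightarrow> 'v \<Rightarrow> real"
  assumes "finite V" "\<And>u v. u \<in> V \<Longrightarrow> v \<in> V \<Longrightarrow> 0 \<le> h u v"
    and "(\<Sum>u\<in>V. \<Sum>v\<in>V. h u v) = 0" "u \<in> V" "v \<in> V"
  shows "h u v = 0"
proof -
  have "(\<Sum>v\<in>V. h u v) = 0"
    by (rule sum_nonneg_0[OF assms(1) _ assms(3,4)]) (simp add: assms(2) sum_nonneg)
  from sum_nonneg_0[OF assms(1) _ this assms(5)] show ?thesis using assms(2,4) by simp
qed

text \<open>The pointwise operator \<open>f \<mapsto> c * A f / a\<close> is self-adjoint for the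
  inner product with weights \<open>a / c\<close>, fixes \<open>c\<close>, and has
  \<open>bil V A\<close> as its form. By \<open>key\<close> a positive eigenvalue
  \<open>\<mu>\<close> satisfies \<open>\<mu> \<le> \<mu>\<^sup>2\<close>, so it is at least 1, and
  \<open>conn\<close> makes its eigenvectors multiples of \<open>c\<close>. Hence the orthogonal
  complement of \<open>c\<close> has no positive eigenvalue.\<close>

lemma trickle_pos:
  fixes A :: "'v \<Rightarrow> 'v \<Rightarrow> real" and c a :: "'v \<Rightarrow> real"
  assumes fin: "finite V" and sym: "\<And>u v. A u v = A v u" and nonneg: "\<And>u v. 0 \<le> A u v"
    and c: "\<And>v. v \<in> V \<Longrightarrow> 0 < c v"
    and a: "\<And>v. v \<in> V \<Longrightarrow> a v = (\<Sum>u\<in>V. A v u * c u)"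
    and a_pos: "\<And>v. v \<in> V \<Longrightarrow> 0 < a v"
    and key: "\<And>f. bil V A f f \<le> (\<Sum>v\<in>V. c v * (\<Sum>u\<in>V. A v u * f u)\<^sup>2 / a v)"
    and conn: "\<And>u v. u \<in> V \<Longrightarrow> v \<in> V \<Longrightarrow> \<exists>w\<in>V. 0 < A u w \<and> 0 < A v w"
    and f: "(\<Sum>v\<in>V. a v * f v) = 0"
  shows "bil V A f f \<le> 0"
proof (rule ccontr)
  assume neg: "\<not> bil V A f f \<le> 0"
  let ?B = "bil V A"
  define l where "l f = (\<Sum>v\<in>V. a v * f v)" for f
  \<comment> \<open>\<open>l f\<close> equals \<open>ip f c\<close>, so \<open>l f = 0\<close>
    describes the complement of \<open>c\<close>.\<close>
  define ip where "ip f g = (\<Sum>v\<in>V. a v / c v * f v * g v)" for f g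
  have ip_sq: "ip (\<lambda>v. f v + t * g v) (\<lambda>v. f v + t * g v) = ip f f + 2 * t * ip f g + t\<^sup>2 * ip g g" for f g t
  proof -
    have "w * (x + t * y) * (x + t * y) = w * x * x + 2 * t * (w * x * y) + t\<^sup>2 * (w * y * y)"
      for w x y :: real by algebra
    then show ?thesis unfolding ip_def by (simp only: sum_distrib_left sum.distrib)
  qed
  have ip_nonneg: "0 \<le> ip f f" for f
    unfolding ip_def using a_pos c
    by (intro sum_nonneg) (simp add: less_imp_le mult.assoc)
  have ip_zero: "f v = 0" if "ip f f = 0" "v \<in> V" for f v
  proof -
    have "a v / c v * f v * f v = 0"
      by (rule sum_nonneg_0[OF fin _ that(1)[unfolded ip_def] that(2)])
        (use a_pos c in \<open>simp add: mult.assoc less_imp_le\<close>)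
    then show ?thesis using a_pos[OF that(2)] c[OF that(2)] by simp
  qed
  \<comment> \<open>A unit vector for \<open>ip\<close> has coordinates of modulus at most
    \<open>sqrt (c v / a v)\<close>. Coordinates outside \<open>V\<close> are pinned to 0, so the
    box is a product of compact sets, whatever the size of the index type.\<close>
  define Box where "Box = (PiE UNIV (\<lambda>v. if v \<in> V then {- sqrt (c v / a v)..sqrt (c v / a v)} else {0::real}))"
  define S where "S = Box \<inter> {f. ip f f = 1} \<inter> {f. l f = 0}"
  have "compactin euclidean Box"
    unfolding Box_def euclidean_product_topology[symmetric] compactin_PiE by auto
  then have cBox: "compact Box" by simp
  have cont_ip: "continuous_on UNIV (\<lambda>f. ip f f)" and cont_l: "continuous_on UNIV l"
    and cont_B: "continuous_on UNIV (\<lambda>f. ?B f f)"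
    unfolding ip_def l_def bil_def
    by (intro continuous_on_sum continuous_on_mult continuous_on_const continuous_on_product_coordinates)+
  have "compact S"
    unfolding S_def
    by (intro compact_Int_closed cBox closed_Collect_eq cont_ip cont_l continuous_on_const)
  have inS: "\<exists>g\<in>S. \<forall>v\<in>V. g v = r * h v"
    if "ip h h \<noteq> 0" "l h = 0" "r = 1 / sqrt (ip h h)" for h r
  proof -
    define g where "g v = (if v \<in> V then r * h v else 0)" for v
    have 1: "ip g g = r\<^sup>2 * ip h h"
      unfolding ip_def g_def sum_distrib_left by (intro sum.cong) (auto simp: power2_eq_square)
    have 2: "l g = r * l h"
      unfolding l_def g_def sum_distrib_left by (intro sum.cong) auto
    have g1: "ip g g = 1" using 1 that(1,3) ip_nonneg[of h] by (simp add: power_divide)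
    have "g v \<in> {- sqrt (c v / a v)..sqrt (c v / a v)}" if "v \<in> V" for v
    proof -
      have "a v / c v * g v * g v \<le> ip g g"
        unfolding ip_def using fin that a_pos c
        by (intro member_le_sum) (auto simp: mult.assoc less_imp_le)
      then have "(g v)\<^sup>2 \<le> c v / a v"
        using g1 a_pos[OF that] c[OF that] by (simp add: field_simps power2_eq_square)
      then have "\<bar>g v\<bar> \<le> sqrt (c v / a v)" using real_sqrt_le_mono by fastforce
      then show ?thesis by auto
    qed
    then have "g \<in> Box" unfolding Box_def by (auto simp: g_def)
    then show ?thesis using g1 2 that(2) unfolding S_def
      by (intro bexI[of _ g]) (auto simp: g_def)
  qed
  have B_cong: "?B g g = ?B h h" if "\<And>v. v \<in> V \<Longrightarrow> g v = h v" for g h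
    unfolding bil_def using that by (intro sum.cong refl) simp
  have B_zero: "?B h h = 0" if "ip h h = 0" for h
    unfolding bil_def using ip_zero[OF that] by simp
  have fS: "ip f f \<noteq> 0" using neg B_zero by force
  have lf: "l f = 0" using f unfolding l_def .
  obtain f1 where f1: "f1 \<in> S" "\<forall>v\<in>V. f1 v = (1 / sqrt (ip f f)) * f v"
    using inS[OF fS lf refl] by blast
  have "S \<noteq> {}" using f1 by auto
  then obtain f0 where f0: "f0 \<in> S" and max: "\<And>g. g \<in> S \<Longrightarrow> ?B g g \<le> ?B f0 f0"
    using continuous_attains_sup[OF \<open>compact S\<close> _ continuous_on_subset[OF cont_B subset_UNIV]] by blast
  \<comment> \<open>The maximum of the Rayleigh quotient on the hyperplane, positive by the contrary
    assumption.\<close>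
  define \<mu> where "\<mu> = ?B f0 f0"
  have f0': "ip f0 f0 = 1" "l f0 = 0" using f0 unfolding S_def by auto
  have "?B f1 f1 = (1 / sqrt (ip f f))\<^sup>2 * ?B f f"
    unfolding bil_scale[symmetric] using f1(2) by (intro B_cong) simp
  moreover have "\<dots> > 0" using neg fS by simp
  ultimately have lam_pos: "\<mu> > 0" using max[OF f1(1)] unfolding \<mu>_def by linarith
  have bound: "?B h h \<le> \<mu> * ip h h" if lh0: "l h = 0" for h
  proof (cases "ip h h = 0")
    case True then show ?thesis using B_zero by simp
  next
    case False
    obtain g where g: "g \<in> S" "\<forall>v\<in>V. g v = (1 / sqrt (ip h h)) * h v"
      using inS[OF False lh0 refl] by blast
    have "?B g g = (1 / sqrt (ip h h))\<^sup>2 * ?B h h"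
      unfolding bil_scale[symmetric] using g(2) by (intro B_cong) simp
    then have "?B h h / ip h h \<le> \<mu>" using max[OF g(1)] ip_nonneg[of h]
      unfolding \<mu>_def by (simp add: power_divide)
    then show ?thesis using False ip_nonneg[of h] by (simp add: pos_divide_le_eq)
  qed
  have eigen: "?B f0 h = \<mu> * ip f0 h" if "l h = 0" for h
  proof -
    \<comment> \<open>First variation: \<open>f0 + t * h\<close> stays in the hyperplane, and
      \<open>bound\<close> there is a quadratic inequality in \<open>t\<close> without constant
      term.\<close>
    have "0 \<le> 2 * t * (\<mu> * ip f0 h - ?B f0 h) + t\<^sup>2 * (\<mu> * ip h h - ?B h h)" for t
    proof -
      have "l (\<lambda>v. f0 v + t * h v) = l f0 + t * l h"
        unfolding l_def by (simp add: sum.distrib sum_distrib_left algebra_simps)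
      then have "l (\<lambda>v. f0 v + t * h v) = 0" using that f0' by simp
      from bound[OF this] show ?thesis
        unfolding bil_square[OF sym] ip_sq f0'(1) \<mu>_def[symmetric] by (simp add: algebra_simps)
    qed
    from linear_coeff_zero[OF this] show ?thesis by simp
  qed
  define Af where "Af v = (\<Sum>u\<in>V. A v u * f0 u)" for v
  \<comment> \<open>The residual of the eigenvalue equation. It lies in the hyperplane, so the
    equation may be tested against \<open>h\<close> itself, which gives
    \<open>ip h h = 0\<close>.\<close>
  define h where "h v = c v * Af v / a v - \<mu> * f0 v" for v
  have "(\<Sum>v\<in>V. c v * Af v) = ?B c f0" unfolding bil_rows Af_def by simp
  also have "\<dots> = ?B f0 c" by (rule bil_commute[OF sym])
  also have "\<dots> = l f0" unfolding bil_rows l_def using a by (simp add: mult.commute)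
  finally have cAf: "(\<Sum>v\<in>V. c v * Af v) = 0" using f0' by simp
  have "l h = (\<Sum>v\<in>V. c v * Af v) - \<mu> * l f0"
    unfolding l_def h_def sum_distrib_left sum_subtractf[symmetric]
  proof (rule sum.cong[OF refl])
    fix v assume "v \<in> V"
    from a_pos[OF this] show "a v * (c v * Af v / a v - \<mu> * f0 v) = c v * Af v - \<mu> * (a v * f0 v)"
      by (simp add: field_simps)
  qed
  then have lh: "l h = 0" using cAf f0' by simp
  have hAf: "?B h f0 = (\<Sum>v\<in>V. h v * Af v)" unfolding bil_rows Af_def ..
  have "ip h h = ?B h f0 - \<mu> * ip f0 h"
    unfolding ip_def hAf sum_distrib_left sum_subtractf[symmetric]
  proof (rule sum.cong[OF refl])
    fix v assume v: "v \<in> V"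
    show "a v / c v * h v * h v = h v * Af v - \<mu> * (a v / c v * f0 v * h v)"
      using a_pos[OF v] c[OF v]
      by (simp add: h_def field_simps)
  qed
  then have "ip h h = 0" using eigen[OF lh] bil_commute[OF sym, where f = h and g = f0] by simp
  then have hz: "c v * Af v / a v = \<mu> * f0 v" if "v \<in> V" for v
    using ip_zero[OF _ that, of h] by (simp add: h_def)
  \<comment> \<open>At the eigenvector \<open>f0\<close> the right-hand side of \<open>key\<close>
    is \<open>\<mu>\<^sup>2\<close>, so positivity of \<open>\<mu>\<close> yields
    \<open>1 \<le> \<mu>\<close>.\<close>
  have "\<mu> \<le> (\<Sum>v\<in>V. c v * (Af v)\<^sup>2 / a v)" unfolding \<mu>_def Af_def by (rule key)
  also have "\<dots> = (\<Sum>v\<in>V. \<mu>\<^sup>2 * (a v / c v * f0 v * f0 v))"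
  proof (rule sum.cong[OF refl])
    fix v assume v: "v \<in> V"
    have "c v * (Af v)\<^sup>2 / a v = (c v * Af v / a v)\<^sup>2 * (a v / c v)"
      using a_pos[OF v] c[OF v] by (simp add: field_simps power2_eq_square)
    then show "c v * (Af v)\<^sup>2 / a v = \<mu>\<^sup>2 * (a v / c v * f0 v * f0 v)"
      using hz[OF v] by (simp add: power2_eq_square)
  qed
  also have "\<dots> = \<mu>\<^sup>2" using f0'(1) unfolding ip_def sum_distrib_left[symmetric] by simp
  finally have lam: "1 \<le> \<mu>" using lam_pos by (simp add: power2_eq_square)
  define g where "g v = f0 v / c v" for v
  have f0g: "f0 v = c v * g v" if "v \<in> V" for v using c[OF that] by (simp add: g_def)
  \<comment> \<open>The Dirichlet form of an eigenvector with eigenvalue at least 1 vanishes.\<close>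
  have "(\<Sum>u\<in>V. \<Sum>v\<in>V. A u v * c u * c v * (g u - g v)\<^sup>2) =
      (\<Sum>u\<in>V. \<Sum>v\<in>V. A u v * c v * (c u * (g u)\<^sup>2)) + (\<Sum>u\<in>V. \<Sum>v\<in>V. A u v * c u * (c v * (g v)\<^sup>2))
      - 2 * (\<Sum>u\<in>V. \<Sum>v\<in>V. A u v * (c u * g u) * (c v * g v))"
    unfolding sum_distrib_left sum.distrib[symmetric] sum_subtractf[symmetric]
    by (intro sum.cong refl) (simp add: power2_eq_square algebra_simps)
  also have "(\<Sum>u\<in>V. \<Sum>v\<in>V. A u v * c u * (c v * (g v)\<^sup>2)) = (\<Sum>u\<in>V. \<Sum>v\<in>V. A u v * c v * (c u * (g u)\<^sup>2))"
    by (subst sum.swap) (simp add: sym)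
  also have "(\<Sum>u\<in>V. \<Sum>v\<in>V. A u v * c v * (c u * (g u)\<^sup>2)) = (\<Sum>u\<in>V. a u * (c u * (g u)\<^sup>2))"
    unfolding sum_distrib_right[symmetric] using a by (intro sum.cong) auto
  also have "\<dots> = ip f0 f0"
    unfolding ip_def using f0g c by (intro sum.cong refl) (simp add: power2_eq_square)
  also have "(\<Sum>u\<in>V. \<Sum>v\<in>V. A u v * (c u * g u) * (c v * g v)) = \<mu>"
    unfolding \<mu>_def bil_def using f0g by (intro sum.cong refl) simp
  finally have "(\<Sum>u\<in>V. \<Sum>v\<in>V. A u v * c u * c v * (g u - g v)\<^sup>2) \<le> 0"
    using lam f0' by simp
  moreover have nn: "0 \<le> A u v * c u * c v * (g u - g v)\<^sup>2" if "u \<in> V" "v \<in> V" for u v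
    using that nonneg c by (simp add: less_imp_le)
  ultimately have "(\<Sum>u\<in>V. \<Sum>v\<in>V. A u v * c u * c v * (g u - g v)\<^sup>2) = 0"
    by (intro antisym sum_nonneg) auto
  then have dz: "A u v * c u * c v * (g u - g v)\<^sup>2 = 0" if "u \<in> V" "v \<in> V" for u v
    using double_sum_nonneg_0[where h = "\<lambda>u v. A u v * c u * c v * (g u - g v)\<^sup>2", OF fin nn] that by blast
  have adj: "g u = g v" if "u \<in> V" "v \<in> V" "0 < A u v" for u v
  proof -
    have "A u v * c u * c v * (g u - g v)\<^sup>2 = 0" using dz that by blast
    then show ?thesis using c[OF that(1)] c[OF that(2)] that(3) by simp
  qed
  have const: "g u = g v" if uv: "u \<in> V" "v \<in> V" for u v
  proof -
    obtain w where "w \<in> V" "0 < A u w" "0 < A v w" using conn[OF uv] by blast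
    then show ?thesis using adj[of u w] adj[of v w] uv by simp
  qed
  have "V \<noteq> {}" using f0' unfolding ip_def by auto
  then obtain x where x: "x \<in> V" by auto
  \<comment> \<open>By now \<open>f0\<close> is a multiple of \<open>c\<close>, and \<open>l\<close>
    is positive at \<open>c\<close>, so the multiple is 0.\<close>
  have "l f0 = g x * (\<Sum>v\<in>V. a v * c v)"
    unfolding l_def sum_distrib_left
  proof (intro sum.cong refl)
    fix v assume v: "v \<in> V"
    show "a v * f0 v = g x * (a v * c v)" using f0g[OF v] const[OF v x] by simp
  qed
  moreover have "(\<Sum>v\<in>V. a v * c v) > 0"
    using fin \<open>V \<noteq> {}\<close> a_pos c by (intro sum_pos) auto
  ultimately have "g x = 0" using f0' by simp
  then have "\<forall>v\<in>V. f0 v = 0" using const[OF _ x] f0g by simp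
  then show False using f0' unfolding ip_def by simp
qed

text \<open>Where \<open>a v\<close> vanishes, the whole row of \<open>v\<close> vanishes, since
  \<open>c\<close> is positive and the entries are nonnegative. Deleting these points leads to
  \<open>trickle_pos\<close>.\<close>

lemma trickle:
  fixes A :: "'v \<Rightarrow> 'v \<Rightarrow> real" and c a :: "'v \<Rightarrow> real"
  assumes fin: "finite V" and sym: "\<And>u v. A u v = A v u" and nonneg: "\<And>u v. 0 \<le> A u v"
    and c: "\<And>v. v \<in> V \<Longrightarrow> 0 < c v"
    and a: "\<And>v. v \<in> V \<Longrightarrow> a v = (\<Sum>u\<in>V. A v u * c u)"
    and key: "\<And>f. bil V A f f \<le> (\<Sum>v\<in>V. c v * (\<Sum>u\<in>V. A v u * f u)\<^sup>2 / a v)"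
    and conn: "\<And>u v. u \<in> V \<Longrightarrow> v \<in> V \<Longrightarrow> 0 < a u \<Longrightarrow> 0 < a v \<Longrightarrow> \<exists>w\<in>V. 0 < A u w \<and> 0 < A v w"
  shows "hyperbolic V A"
proof -
  define W where "W = {v \<in> V. 0 < a v}"
  have WV: "W \<subseteq> V" "finite W" using fin by (auto simp: W_def)
  have zero: "A u v = 0" if "u \<in> V" "v \<in> V" "u \<notin> W \<or> v \<notin> W" for u v
  proof -
    have *: "A u v = 0" if "u \<in> V" "v \<in> V" "u \<notin> W" for u v
    proof -
      have nn: "\<And>u v. v \<in> V \<Longrightarrow> 0 \<le> A u v * c v" using nonneg c by (simp add: less_imp_le)
      have "(\<Sum>v\<in>V. A u v * c v) \<le> 0" using that a by (auto simp: W_def)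
      then have "(\<Sum>v\<in>V. A u v * c v) = 0"
        by (intro antisym sum_nonneg) (auto simp: nn)
      then have "\<forall>v\<in>V. A u v * c v = 0"
        by (subst (asm) sum_nonneg_eq_0_iff) (auto simp: fin nn)
      then show ?thesis using c that by fastforce
    qed
    show ?thesis using *[of u v] *[of v u] sym[of u v] that by auto
  qed
  have rowW: "(\<Sum>u\<in>V. A v u * f u) = (\<Sum>u\<in>W. A v u * f u)" if "v \<in> V" for v f
    using WV zero that by (intro sum.mono_neutral_right fin) auto
  have bilW: "bil V A f g = bil W A f g" for f g
  proof -
    have "bil V A f g = (\<Sum>u\<in>V. f u * (\<Sum>v\<in>W. A u v * g v))"
      unfolding bil_rows using rowW by simp
    also have "\<dots> = bil W A f g"
      unfolding bil_rows using WV zero by (intro sum.mono_neutral_right fin) (auto intro!: sum.neutral)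
    finally show ?thesis .
  qed
  show ?thesis
  proof (rule hyperbolicI[OF sym nonneg])
    fix f :: "'v \<Rightarrow> real"
    assume f: "(\<Sum>v\<in>V. (if v \<in> W then a v else 0) * f v) = 0"
    have "(\<Sum>v\<in>V. (if v \<in> W then a v else 0) * f v) = (\<Sum>v\<in>W. a v * f v)"
      using WV by (intro sum.mono_neutral_cong_right fin) auto
    then have f': "(\<Sum>v\<in>W. a v * f v) = 0" using f by simp
    have "bil W A f f \<le> 0"
    proof (rule trickle_pos[OF WV(2) sym nonneg _ _ _ _ _ f'])
      show "0 < c v" if "v \<in> W" for v using that WV c by auto
      show "0 < a v" if "v \<in> W" for v using that by (simp add: W_def)
      show "a v = (\<Sum>u\<in>W. A v u * c u)" if "v \<in> W" for v
        using a[of v] rowW[of v c] that WV by auto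
      show "\<exists>w\<in>W. 0 < A u w \<and> 0 < A v w" if "u \<in> W" "v \<in> W" for u v
      proof -
        obtain w where w: "w \<in> V" "0 < A u w" "0 < A v w"
          using conn[of u v] \<open>u \<in> W\<close> \<open>v \<in> W\<close> unfolding W_def by blast
        then have "w \<in> W" using zero[of u w] that WV by auto
        then show ?thesis using w by blast
      qed
      show "bil W A f f \<le> (\<Sum>v\<in>W. c v * (\<Sum>u\<in>W. A v u * f u)\<^sup>2 / a v)" for f
      proof -
        have "bil W A f f \<le> (\<Sum>v\<in>V. c v * (\<Sum>u\<in>V. A v u * f u)\<^sup>2 / a v)"
          using key[of f] bilW by simp
        also have "\<dots> = (\<Sum>v\<in>W. c v * (\<Sum>u\<in>W. A v u * f u)\<^sup>2 / a v)"
        proof (rule sum.mono_neutral_cong_right[OF fin WV(1)])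
          show "\<forall>v\<in>V - W. c v * (\<Sum>u\<in>V. A v u * f u)\<^sup>2 / a v = 0" using zero by simp
          show "c v * (\<Sum>u\<in>V. A v u * f u)\<^sup>2 / a v = c v * (\<Sum>u\<in>W. A v u * f u)\<^sup>2 / a v"
            if "v \<in> W" for v using rowW that WV by auto
        qed
        finally show ?thesis .
      qed
    qed
    then show "bil V A f f \<le> 0" by (simp add: bilW)
  qed
qed

section \<open>Polarized forms\<close>

text \<open>\<open>\<phi>\<close> holds the partial derivatives of top degree of a polynomial, indexed by multisets of variables;
  \<open>mix V \<phi> cs s\<close> is the derivative along the directions \<open>cs\<close> and the variables in \<open>s\<close>.\<close>

fun mix :: "'v set \<Rightarrow> ('v multiset \<Rightarrow> real) \<Rightarrow> ('v \<Rightarrow> real) list \<Rightarrow> 'v multiset \<Rightarrow> real" where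
  "mix V \<phi> [] s = \<phi> s"
| "mix V \<phi> (c # cs) s = (\<Sum>v\<in>V. c v * mix V \<phi> cs (add_mset v s))"

text \<open>Says that the derivative along \<open>s\<close> still has a monomial with positive
  coefficient. Extendable multisets are the faces of a multicomplex whose links carry the
  connectedness condition.\<close>

definition extendable :: "'v set \<Rightarrow> ('v multiset \<Rightarrow> real) \<Rightarrow> nat \<Rightarrow> 'v multiset \<Rightarrow> bool" where
  "extendable V \<phi> d s \<longleftrightarrow> (\<exists>t. set_mset t \<subseteq> V \<and> size s + size t = d \<and> 0 < \<phi> (s + t))"

lemma mix_swap: "mix V \<phi> (c # c' # cs) s = mix V \<phi> (c' # c # cs) s"
  by (simp add: sum_distrib_left) (subst sum.swap, simp add: add_mset_commute mult_ac)

lemma mix_move: "mix V \<phi> (xs @ c # ys) s = mix V \<phi> (c # xs @ ys) s"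
proof (induction xs arbitrary: s)
  case (Cons x xs)
  have "mix V \<phi> ((x # xs) @ c # ys) s = mix V \<phi> (x # c # xs @ ys) s"
    using Cons by simp
  then show ?case by (metis mix_swap append_Cons)
qed simp

text \<open>Directional derivatives commute.\<close>

lemma mix_perm: "mset xs = mset ys \<Longrightarrow> mix V \<phi> xs s = mix V \<phi> ys s"
proof (induction xs arbitrary: ys s)
  case (Cons x xs)
  have "x \<in> set ys" using Cons.prems by (metis list.set_intros(1) set_mset_mset)
  then obtain as bs where ys: "ys = as @ x # bs" by (meson split_list)
  then have "mset xs = mset (as @ bs)" using Cons.prems by simp
  then have "mix V \<phi> (x # xs) s = mix V \<phi> (x # as @ bs) s" using Cons.IH[of "as @ bs"] by simp
  then show ?case using ys mix_move by metis
qed simp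

section \<open>Hyperbolicity of mixed derivatives, from local to global\<close>

lemma mix_bil:
  "mix V \<phi> (f # g # cs) s = bil V (\<lambda>u v. mix V \<phi> cs (add_mset u (add_mset v s))) f g"
  unfolding bil_rows by (simp add: add_mset_commute mult.commute)

lemma mix_nonneg:
  assumes "\<And>s. 0 \<le> \<phi> s" "\<And>c v. c \<in> set cs \<Longrightarrow> v \<in> V \<Longrightarrow> 0 \<le> c v"
  shows "0 \<le> mix V \<phi> cs s"
  using assms(2) by (induction cs arbitrary: s) (auto simp: assms(1) intro!: sum_nonneg)

text \<open>Strictly positive directions involve every variable and nothing cancels, so positivity
  depends only on the support of \<open>\<phi>\<close>.\<close>

lemma mix_pos_iff:
  assumes fin: "finite V" and \<phi>: "\<And>s. 0 \<le> \<phi> s"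
    and "\<And>c v. c \<in> set cs \<Longrightarrow> v \<in> V \<Longrightarrow> 0 < c v"
  shows "0 < mix V \<phi> cs s \<longleftrightarrow> extendable V \<phi> (size s + length cs) s"
  using assms(3)
proof (induction cs arbitrary: s)
  case Nil
  then show ?case by (auto simp: extendable_def)
next
  case (Cons c cs)
  have nn: "0 \<le> c v * mix V \<phi> cs (add_mset v s)" if "v \<in> V" for v
    using Cons.prems that \<phi> by (intro mult_nonneg_nonneg mix_nonneg) (auto intro: less_imp_le)
  have "0 < mix V \<phi> (c # cs) s \<longleftrightarrow> (\<exists>v\<in>V. 0 < c v * mix V \<phi> cs (add_mset v s))"
    using nn fin sum_nonneg_eq_0_iff[OF fin nn] sum_nonneg[of V, OF nn] by (force simp: less_le)
  also have "\<dots> \<longleftrightarrow> (\<exists>v\<in>V. extendable V \<phi> (size s + length (c # cs)) (add_mset v s))"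
  proof (intro bex_cong refl)
    fix v assume "v \<in> V"
    then have "0 < c v" using Cons.prems by simp
    then show "0 < c v * mix V \<phi> cs (add_mset v s) \<longleftrightarrow>
        extendable V \<phi> (size s + length (c # cs)) (add_mset v s)"
      using Cons.IH[of "add_mset v s"] Cons.prems by (simp add: zero_less_mult_iff)
  qed
  also have "\<dots> \<longleftrightarrow> extendable V \<phi> (size s + length (c # cs)) s"
  proof
    assume "\<exists>v\<in>V. extendable V \<phi> (size s + length (c # cs)) (add_mset v s)"
    then obtain v t where "v \<in> V" "set_mset t \<subseteq> V" "size t = length cs" "0 < \<phi> (add_mset v s + t)"
      by (auto simp: extendable_def)
    then show "extendable V \<phi> (size s + length (c # cs)) s"
      unfolding extendable_def by (intro exI[of _ "add_mset v t"]) auto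
  next
    assume "extendable V \<phi> (size s + length (c # cs)) s"
    then obtain t where t: "set_mset t \<subseteq> V" "size t = Suc (length cs)" "0 < \<phi> (s + t)"
      by (auto simp: extendable_def)
    then obtain v t' where "t = add_mset v t'" by (metis size_eq_Suc_imp_eq_union)
    then show "\<exists>v\<in>V. extendable V \<phi> (size s + length (c # cs)) (add_mset v s)"
      using t unfolding extendable_def by (intro bexI[of _ v] exI[of _ t']) auto
  qed
  finally show ?case .
qed

text \<open>Induction on the number of directions. The form with \<open>c\<close> added is the sum,
  weighted by \<open>c\<close>, of the forms with one more variable \<open>w\<close> in
  \<open>s\<close>. Those are hyperbolic by induction, and testing them against \<open>c\<close>
  gives exactly the key hypothesis of \<open>trickle\<close>.\<close>

lemma mix_hyperbolic_pos:
  fixes \<phi> :: "'v multiset \<Rightarrow> real"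
  assumes fin: "finite V" and \<phi>: "\<And>s. 0 \<le> \<phi> s"
    and loc: "\<And>s. size s + 2 = d \<Longrightarrow> hyperbolic V (\<lambda>u v. \<phi> (add_mset u (add_mset v s)))"
    and conn: "\<And>s u v. size s + 3 \<le> d \<Longrightarrow> u \<in> V \<Longrightarrow> v \<in> V \<Longrightarrow>
      extendable V \<phi> d (add_mset u s) \<Longrightarrow> extendable V \<phi> d (add_mset v s) \<Longrightarrow>
      \<exists>w\<in>V. extendable V \<phi> d (add_mset w (add_mset u s)) \<and> extendable V \<phi> d (add_mset w (add_mset v s))"
    and pos: "\<And>c v. c \<in> set cs \<Longrightarrow> v \<in> V \<Longrightarrow> 0 < c v"
    and size: "size s + length cs + 2 = d"
  shows "hyperbolic V (\<lambda>u v. mix V \<phi> cs (add_mset u (add_mset v s)))"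
  using pos size
proof (induction cs arbitrary: s)
  case Nil
  then show ?case using loc by simp
next
  case (Cons c cs)
  let ?A = "\<lambda>u v. mix V \<phi> (c # cs) (add_mset u (add_mset v s))"
  let ?a = "\<lambda>v. mix V \<phi> (c # c # cs) (add_mset v s)"
  have c: "0 < c v" if "v \<in> V" for v using Cons.prems that by simp
  have pos': "0 < c' v" if "c' \<in> set cs" "v \<in> V" for c' v using Cons.prems that by simp
  have nn: "0 \<le> mix V \<phi> cs s" for s
    using pos' by (intro mix_nonneg \<phi>) (auto intro: less_imp_le)
  show ?case
  proof (rule trickle[where c = c and a = ?a, OF fin])
    show "?A u v = ?A v u" for u v by (simp only: add_mset_commute)
    show "0 \<le> ?A u v" for u v
      using Cons.prems(1) by (intro mix_nonneg \<phi>) (auto intro: less_imp_le)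
    show "0 < c v" if "v \<in> V" for v by (rule c[OF that])
    show "?a v = (\<Sum>u\<in>V. ?A v u * c u)" for v
      unfolding mix.simps(2)[of V \<phi> c "c # cs"] by (simp only: add_mset_commute mult.commute)
    show "bil V ?A f f \<le> (\<Sum>v\<in>V. c v * (\<Sum>u\<in>V. ?A v u * f u)\<^sup>2 / ?a v)" for f
    proof -
      define D where "D w u v = mix V \<phi> cs (add_mset u (add_mset v (add_mset w s)))" for w u v
      \<comment> \<open>With \<open>c\<close> in front, its slot can be expanded into the single
        variables \<open>w\<close>.\<close>
      have "bil V ?A f f = mix V \<phi> (f # f # c # cs) s" by (simp only: mix_bil)
      also have "\<dots> = mix V \<phi> (c # f # f # cs) s" by (rule mix_perm) simp
      also have "\<dots> = (\<Sum>w\<in>V. c w * bil V (D w) f f)"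
        unfolding mix.simps(2)[of V \<phi> c "f # f # cs"] mix_bil[of V \<phi> f f cs] D_def ..
      also have "\<dots> \<le> (\<Sum>w\<in>V. c w * (\<Sum>u\<in>V. ?A w u * f u)\<^sup>2 / ?a w)"
      proof (rule sum_mono)
        fix w assume w: "w \<in> V"
        have cc: "bil V (D w) c c = ?a w" unfolding mix_bil D_def ..
        have "bil V (D w) f c = mix V \<phi> (f # c # cs) (add_mset w s)" unfolding mix_bil D_def ..
        also have "\<dots> = (\<Sum>u\<in>V. ?A w u * f u)"
          unfolding mix.simps(2)[of V \<phi> f "c # cs"] by (simp only: add_mset_commute mult.commute)
        finally have fc: "bil V (D w) f c = (\<Sum>u\<in>V. ?A w u * f u)" .
        have "hyperbolic V (D w)"
          unfolding D_def using Cons.IH[of "add_mset w s"] Cons.prems by simp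
        then have "bil V (D w) f f * ?a w \<le> (\<Sum>u\<in>V. ?A w u * f u)\<^sup>2"
          unfolding hyperbolic_def cc[symmetric] fc[symmetric] using c by (simp add: less_imp_le)
        \<comment> \<open>A quotient with denominator 0 is 0, so the bound has to be 0 in this case.
          It is, as \<open>c\<close> is positive and the entries of \<open>D w\<close> are
          nonnegative.\<close>
        moreover have "bil V (D w) f f = 0" if "?a w = 0"
        proof -
          have nnD: "0 \<le> D w u v * c u * c v" if "u \<in> V" "v \<in> V" for u v
            unfolding D_def using nn c that by (simp add: less_imp_le)
          have "(\<Sum>u\<in>V. \<Sum>v\<in>V. D w u v * c u * c v) = 0"
            using that unfolding cc[symmetric] bil_def .
          then have "\<forall>u\<in>V. \<forall>v\<in>V. D w u v * c u * c v = 0"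
            using double_sum_nonneg_0[where h = "\<lambda>u v. D w u v * c u * c v", OF fin nnD] by blast
          then have "\<forall>u\<in>V. \<forall>v\<in>V. D w u v = 0" using c by fastforce
          then show ?thesis unfolding bil_def by simp
        qed
        moreover have "0 \<le> ?a w"
          using Cons.prems(1) by (intro mix_nonneg \<phi>) (auto intro: less_imp_le)
        ultimately have "bil V (D w) f f \<le> (\<Sum>u\<in>V. ?A w u * f u)\<^sup>2 / ?a w"
          by (cases "?a w = 0") (simp_all add: pos_le_divide_eq del: mix.simps)
        from mult_left_mono[OF this, of "c w"]
        show "c w * bil V (D w) f f \<le> c w * (\<Sum>u\<in>V. ?A w u * f u)\<^sup>2 / ?a w"
          using c[OF w] by (simp add: less_imp_le del: mix.simps)
      qed
      finally show ?thesis .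
    qed
    show "\<exists>w\<in>V. 0 < ?A u w \<and> 0 < ?A v w"
      if uv: "u \<in> V" "v \<in> V" "0 < ?a u" "0 < ?a v" for u v
    proof -
      have ext: "extendable V \<phi> d (add_mset u s)" if "0 < ?a u" for u
      proof -
        have "extendable V \<phi> (size (add_mset u s) + length (c # c # cs)) (add_mset u s)"
          using that Cons.prems(1) by (subst mix_pos_iff[symmetric, OF fin \<phi>]) auto
        then show ?thesis using Cons.prems(2) by simp
      qed
      obtain w where w: "w \<in> V" "extendable V \<phi> d (add_mset w (add_mset u s))"
          "extendable V \<phi> d (add_mset w (add_mset v s))"
        using conn[of s u v] uv ext Cons.prems(2) by auto
      have "0 < ?A u w" if "extendable V \<phi> d (add_mset w (add_mset u s))" for u
        using that Cons.prems by (subst mix_pos_iff[OF fin \<phi>]) (auto simp: add_mset_commute)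
      then show ?thesis using w by blast
    qed
  qed
qed

lemma mix_shift_tendsto:
  "((\<lambda>\<epsilon>. mix V \<phi> (map (\<lambda>c v. c v + \<epsilon>) cs) s) \<longlongrightarrow> mix V \<phi> cs s) (at_right 0)"
proof (induction cs arbitrary: s)
  case (Cons c cs)
  have "((\<lambda>\<epsilon>. c v + \<epsilon>) \<longlongrightarrow> c v) (at_right 0)" for v by (rule tendsto_eq_intros refl)+ simp
  then show ?case by (simp, intro tendsto_sum tendsto_mult Cons.IH)
qed simp

text \<open>Nonnegative directions are limits of the strictly positive directions
  \<open>c + \<epsilon>\<close>, and both sides of the inequality are continuous in
  \<open>\<epsilon>\<close>.\<close>

theorem mix_alexandrov_fenchel:
  fixes \<phi> :: "'v multiset \<Rightarrow> real"
  assumes fin: "finite V" and \<phi>: "\<And>s. 0 \<le> \<phi> s"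
    and loc: "\<And>s. size s + 2 = d \<Longrightarrow> hyperbolic V (\<lambda>u v. \<phi> (add_mset u (add_mset v s)))"
    and conn: "\<And>s u v. size s + 3 \<le> d \<Longrightarrow> u \<in> V \<Longrightarrow> v \<in> V \<Longrightarrow>
      extendable V \<phi> d (add_mset u s) \<Longrightarrow> extendable V \<phi> d (add_mset v s) \<Longrightarrow>
      \<exists>w\<in>V. extendable V \<phi> d (add_mset w (add_mset u s)) \<and> extendable V \<phi> d (add_mset w (add_mset v s))"
    and cs: "\<And>c v. c \<in> set cs \<Longrightarrow> v \<in> V \<Longrightarrow> 0 \<le> c v"
    and g: "\<And>v. v \<in> V \<Longrightarrow> 0 \<le> g v"
    and size: "length cs + 2 = d"
  shows "mix V \<phi> (f # f # cs) {#} * mix V \<phi> (g # g # cs) {#} \<le> (mix V \<phi> (f # g # cs) {#})\<^sup>2"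
proof -
  define C where "C \<epsilon> = map (\<lambda>c v. c v + \<epsilon>) cs" for \<epsilon> :: real
  have lim: "((\<lambda>\<epsilon>. mix V \<phi> (f # g # C \<epsilon>) {#}) \<longlongrightarrow> mix V \<phi> (f # g # cs) {#}) (at_right 0)" for f g
    unfolding C_def mix.simps by (intro tendsto_sum tendsto_mult mix_shift_tendsto tendsto_const)
  have "mix V \<phi> (f # f # C \<epsilon>) {#} * mix V \<phi> (g # g # C \<epsilon>) {#} \<le> (mix V \<phi> (f # g # C \<epsilon>) {#})\<^sup>2"
    if "0 < \<epsilon>" for \<epsilon>
  proof -
    have "hyperbolic V (\<lambda>u v. mix V \<phi> (C \<epsilon>) (add_mset u (add_mset v {#})))"
    proof (rule mix_hyperbolic_pos[OF fin \<phi> loc conn])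
      show "0 < c v" if "c \<in> set (C \<epsilon>)" "v \<in> V" for c v
        using that cs \<open>0 < \<epsilon>\<close> unfolding C_def by (auto intro: add_nonneg_pos)
      show "size {#} + length (C \<epsilon>) + 2 = d" using size by (simp add: C_def)
    qed
    then show ?thesis unfolding mix_bil hyperbolic_def using g by blast
  qed
  then have "eventually (\<lambda>\<epsilon>. mix V \<phi> (f # f # C \<epsilon>) {#} * mix V \<phi> (g # g # C \<epsilon>) {#}
      \<le> (mix V \<phi> (f # g # C \<epsilon>) {#})\<^sup>2) (at_right 0)"
    by (auto simp: eventually_at_filter)
  from tendsto_le[OF _ tendsto_power[OF lim] tendsto_mult[OF lim lim] this]
  show ?thesis by simp
qed

section \<open>Matroids of nullity at most two\<close>

text \<open>\<open>None\<close> stands for the homogenizing variable \<open>w\<^sub>0\<close>.\<close>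

definition config :: "nat \<Rightarrow> 'a set \<Rightarrow> 'a option multiset" where
  "config p S = replicate_mset p None + image_mset Some (mset_set S)"

lemma count_config_None [simp]: "count (config p S) None = p"
  unfolding config_def by (auto simp: count_eq_zero_iff)

lemma count_config_Some [simp]:
  assumes "finite S"
  shows "count (config p S) (Some x) = (if x \<in> S then 1 else 0)"
  using assms by (induction S) (auto simp: config_def)

lemma size_config [simp]: "size (config p S) = p + card S"
  by (simp add: config_def)

lemma multiset_option_eqI:
  assumes "count s None = count t None" "\<And>x. count s (Some x) = count t (Some x)"
  shows "s = t"
proof (rule multiset_eqI)
  fix y show "count s y = count t y" using assms by (cases y) auto
qed

lemma config_inject:
  assumes "finite S" "finite T" "config p S = config q T"
  shows "p = q" "S = T"
proof -
  show "p = q" using assms(3) by (metis count_config_None)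
  show "S = T"
  proof (rule set_eqI)
    fix x
    have "count (config p S) (Some x) = count (config q T) (Some x)" using assms(3) by simp
    then show "x \<in> S \<longleftrightarrow> x \<in> T" using assms(1,2) by (simp split: if_splits)
  qed
qed

lemma add_None_config [simp]: "add_mset None (config p S) = config (Suc p) S"
  by (simp add: config_def)

lemma add_Some_config [simp]:
  "finite S \<Longrightarrow> x \<notin> S \<Longrightarrow> add_mset (Some x) (config p S) = config p (insert x S)"
  by (simp add: config_def)

text \<open>Each \<open>Some x\<close> occurs at most once, so a summand is determined by its
  support and the multiplicity of \<open>None\<close>.\<close>

lemma config_summand:
  assumes "finite S" "s + t = config p S"
  obtains q T where "T \<subseteq> S" "s = config q T"
proof
  let ?T = "{x. Some x \<in># s}"
  have c: "count s (Some x) + count t (Some x) = (if x \<in> S then 1 else 0)" for x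
    using assms by (metis count_config_Some count_union)
  have *: "count s (Some x) = (if Some x \<in># s then 1 else 0)" for x
  proof -
    have "count s (Some x) = 0 \<or> count s (Some x) = 1" using c[of x] by (auto split: if_splits)
    then show ?thesis by (metis count_eq_zero_iff zero_neq_one)
  qed
  show T: "?T \<subseteq> S"
  proof
    fix x assume "x \<in> ?T"
    then have "0 < count s (Some x)" by simp
    then have "count s (Some x) + count t (Some x) \<noteq> 0" by linarith
    then show "x \<in> S" using c[of x] by metis
  qed
  show "s = config (count s None) ?T"
    using finite_subset[OF T assms(1)] * by (intro multiset_option_eqI) auto
qed

text \<open>Grouping by the values of \<open>c\<close> turns the sum into a sum of squares of class
  sums.\<close>

lemma sum_same_class_nonneg:
  fixes x :: "'a \<Rightarrow> real" and c :: "'a \<Rightarrow> 'b"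
  assumes "finite W"
  shows "0 \<le> (\<Sum>i\<in>W. \<Sum>j\<in>W. if c i = c j then x i * x j else 0)"
proof -
  have "(\<Sum>i\<in>W. \<Sum>j\<in>W. if c i = c j then x i * x j else 0) = (\<Sum>i\<in>W. x i * (\<Sum>j | j \<in> W \<and> c j = c i. x j))"
  proof (rule sum.cong[OF refl])
    fix i
    have "(\<Sum>j\<in>W. if c i = c j then x i * x j else 0) = (\<Sum>j | j \<in> W \<and> c j = c i. x i * x j)"
      using assms by (intro sum.mono_neutral_cong_right) auto
    then show "(\<Sum>j\<in>W. if c i = c j then x i * x j else 0) = x i * (\<Sum>j | j \<in> W \<and> c j = c i. x j)"
      by (simp add: sum_distrib_left)
  qed
  also have "\<dots> = (\<Sum>y\<in>c ` W. \<Sum>i | i \<in> W \<and> c i = y. x i * (\<Sum>j | j \<in> W \<and> c j = c i. x j))"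
    by (rule sum.image_gen[OF assms])
  also have "\<dots> = (\<Sum>y\<in>c ` W. (\<Sum>i | i \<in> W \<and> c i = y. x i)\<^sup>2)"
    by (intro sum.cong refl) (simp add: power2_eq_square sum_distrib_right)
  finally show ?thesis by (simp add: sum_nonneg)
qed

lemma double_sum_off_diagonal:
  fixes x :: "'a \<Rightarrow> real"
  assumes "finite F"
  shows "(\<Sum>i\<in>F. \<Sum>j\<in>F. if i \<noteq> j then x i * x j else 0) = (\<Sum>i\<in>F. x i)\<^sup>2 - (\<Sum>i\<in>F. (x i)\<^sup>2)"
proof -
  have "(\<Sum>j\<in>F. if i \<noteq> j then x i * x j else 0) = x i * (\<Sum>j\<in>F. x j) - (x i)\<^sup>2" if "i \<in> F" for i
  proof -
    have "(\<Sum>j\<in>F. if i \<noteq> j then x i * x j else 0) = (\<Sum>j\<in>F. x i * x j - (if j = i then (x i)\<^sup>2 else 0))"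
      by (intro sum.cong) (auto simp: power2_eq_square)
    then show ?thesis using assms that by (simp add: sum_subtractf sum_distrib_left)
  qed
  then show ?thesis by (simp add: sum_subtractf power2_eq_square sum_distrib_right)
qed

section \<open>Quadratic forms of sets of nullity one and two\<close>

context matroid
begin

lemma indep_finite: "indep I \<Longrightarrow> finite I"
  using finite_carrier indep_subset_carrier finite_subset by blast

text \<open>\<open>C\<close> is the unique circuit of \<open>F\<close>, so deleting two elements
  leaves an independent set exactly when one of them lies in \<open>C\<close>. The form is therefore
  the off-diagonal sum over \<open>F\<close> minus the one over \<open>F - C\<close>.\<close>

lemma nullity_one_form:
  fixes x :: "'a \<Rightarrow> real"
  assumes F: "F \<subseteq> carrier" "\<not> indep F" and C: "C = {i \<in> F. indep (F - {i})}" "C \<noteq> {}"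
    and L: "(\<Sum>i\<in>C. x i) = 0"
  shows "(\<Sum>i\<in>F. \<Sum>j\<in>F. if i \<noteq> j \<and> indep (F - {i, j}) then x i * x j else 0) \<le> 0"
proof -
  have CF: "C \<subseteq> F" using C by auto
  have fin: "finite F" "finite C"
    using finite_subset[OF F(1) finite_carrier] finite_subset[OF CF] by auto
  have iff: "indep (F - {i, j}) \<longleftrightarrow> i \<in> C \<or> j \<in> C" if ij: "i \<in> F" "j \<in> F" "i \<noteq> j" for i j
  proof
    assume ind: "indep (F - {i, j})"
    obtain c where c: "c \<in> F" "indep (F - {c})" using C by auto
    \<comment> \<open>The element gained by augmentation lies in \<open>F\<close> but outside
      \<open>F - {i, j}\<close>, so it restores \<open>i\<close> or \<open>j\<close>.\<close>
    have "card (F - {i, j}) < card (F - {c})"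
      using fin(1) ij c card_mono[OF fin(1), of "{i, j}"] by (auto simp: card_Diff_subset)
    then obtain y where y: "y \<in> (F - {c}) - (F - {i, j})" "indep (insert y (F - {i, j}))"
      using augment[OF ind c(2)] by blast
    have eq: "insert i (F - {i, j}) = F - {j}" "insert j (F - {i, j}) = F - {i}" using ij by auto
    from y(1) have "y = i \<or> y = j" by auto
    then have "indep (F - {j}) \<or> indep (F - {i})" using y(2) eq by metis
    then show "i \<in> C \<or> j \<in> C" using C(1) ij by blast
  next
    assume "i \<in> C \<or> j \<in> C"
    then have "indep (F - {i}) \<or> indep (F - {j})" using C(1) by blast
    then show "indep (F - {i, j})" by (elim disjE) (erule indep_subset, blast)+
  qed
  define K where "K = F - C"
  have finK: "finite K" using fin by (simp add: K_def)
  have sF: "(\<Sum>i\<in>F. g i) = (\<Sum>i\<in>C. g i) + (\<Sum>i\<in>K. g i)" for g :: "'a \<Rightarrow> real"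
    unfolding K_def using sum.subset_diff[OF CF fin(1), of g] by simp
  have "(\<Sum>i\<in>F. \<Sum>j\<in>F. if i \<noteq> j \<and> indep (F - {i, j}) then x i * x j else 0) =
     (\<Sum>i\<in>F. \<Sum>j\<in>F. (if i \<noteq> j then x i * x j else 0) - (if i \<in> K \<and> j \<in> K \<and> i \<noteq> j then x i * x j else 0))"
    by (intro sum.cong refl) (simp add: iff K_def)
  also have "\<dots> = (\<Sum>i\<in>F. \<Sum>j\<in>F. if i \<noteq> j then x i * x j else 0) -
      (\<Sum>i\<in>F. \<Sum>j\<in>F. if i \<in> K \<and> j \<in> K \<and> i \<noteq> j then x i * x j else 0)"
    by (simp only: sum_subtractf)
  also have "(\<Sum>i\<in>F. \<Sum>j\<in>F. if i \<in> K \<and> j \<in> K \<and> i \<noteq> j then x i * x j else 0) =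
      (\<Sum>i\<in>K. \<Sum>j\<in>K. if i \<noteq> j then x i * x j else 0)"
  proof (rule sum.mono_neutral_cong_right[OF fin(1)])
    fix i assume i: "i \<in> K"
    show "(\<Sum>j\<in>F. if i \<in> K \<and> j \<in> K \<and> i \<noteq> j then x i * x j else 0) = (\<Sum>j\<in>K. if i \<noteq> j then x i * x j else 0)"
      by (rule sum.mono_neutral_cong_right[OF fin(1)]) (use i in \<open>auto simp: K_def\<close>)
  qed (auto simp: K_def)
  finally have "(\<Sum>i\<in>F. \<Sum>j\<in>F. if i \<noteq> j \<and> indep (F - {i, j}) then x i * x j else 0) =
      (\<Sum>i\<in>F. x i)\<^sup>2 - (\<Sum>i\<in>F. (x i)\<^sup>2) - ((\<Sum>i\<in>K. x i)\<^sup>2 - (\<Sum>i\<in>K. (x i)\<^sup>2))"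
    unfolding double_sum_off_diagonal[OF fin(1)] double_sum_off_diagonal[OF finK] .
  \<comment> \<open>As \<open>x\<close> sums to 0 over \<open>C\<close>, its sums over
    \<open>F\<close> and \<open>K\<close> agree and their squares cancel.\<close>
  also have "\<dots> = - (\<Sum>i\<in>C. (x i)\<^sup>2)"
    unfolding sF L by simp
  also have "\<dots> \<le> 0" by (simp add: sum_nonneg)
  finally show ?thesis .
qed

text \<open>The relation \<open>i = j \<or> \<not> indep (F - {i, j})\<close> is parallelism in the dual of the restriction to
  \<open>F\<close>, so the form is a square minus the sum of the squares over the parallel classes.\<close>

lemma nullity_two_form:
  fixes x :: "'a \<Rightarrow> real"
  assumes F: "F \<subseteq> carrier" and no: "\<And>i. i \<in> F \<Longrightarrow> \<not> indep (F - {i})"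
    and W: "W = {i \<in> F. \<exists>j\<in>F. j \<noteq> i \<and> indep (F - {i, j})}"
    and L: "(\<Sum>i\<in>W. x i) = 0"
  shows "(\<Sum>i\<in>F. \<Sum>j\<in>F. if i \<noteq> j \<and> indep (F - {i, j}) then x i * x j else 0) \<le> 0"
proof -
  have "W \<subseteq> F" using W by auto
  then have fin: "finite F" "finite W"
    using finite_subset[OF F finite_carrier] finite_subset[of W F] by auto
  define par where "par i j \<longleftrightarrow> i = j \<or> \<not> indep (F - {i, j})" for i j
  have par_sym: "par i j \<longleftrightarrow> par j i" for i j
    unfolding par_def insert_commute[of i j "{}"] by (simp add: eq_commute)
  have JW: "i \<in> W \<and> j \<in> W" if "i \<in> F" "j \<in> F" "i \<noteq> j" "indep (F - {i, j})" for i j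
    using that insert_commute[of i j "{}"] unfolding W by (metis (mono_tags, lifting) mem_Collect_eq)
  \<comment> \<open>If \<open>i\<close> and \<open>k\<close> were not parallel,
    \<open>F - {i, j, k}\<close> would be independent. As \<open>j \<in> W\<close>, there is a
    larger independent set \<open>F - {j, l}\<close>; augmenting from it restores \<open>i\<close>
    or \<open>k\<close> but never \<open>j\<close>, against \<open>p\<close>.\<close>
  have par_trans: "par i k" if W': "i \<in> W" "j \<in> W" "k \<in> W" and p: "par i j" "par j k" for i j k
  proof (rule ccontr)
    assume "\<not> par i k"
    then have ik: "i \<noteq> k" "indep (F - {i, k})" by (auto simp: par_def)
    then have ne: "i \<noteq> j" "k \<noteq> j" using p by (auto simp: par_def)
    then have dep: "\<not> indep (F - {i, j})" "\<not> indep (F - {j, k})" using p by (auto simp: par_def)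
    obtain l where l: "l \<in> F" "l \<noteq> j" "indep (F - {j, l})" using W'(2) W by auto
    have inF: "i \<in> F" "j \<in> F" "k \<in> F" using W' W by auto
    have "indep (F - {i, j, k})" using ik(2) by (rule indep_subset) auto
    moreover have "card (F - {i, j, k}) < card (F - {j, l})"
    proof -
      have "card (F - {i, j, k}) = card F - 3" "card (F - {j, l}) = card F - 2" "3 \<le> card F"
        using fin inF ne ik(1) l card_mono[OF fin(1), of "{i, j, k}"] by (auto simp: card_Diff_subset)
      then show ?thesis by simp
    qed
    ultimately obtain y where y: "y \<in> (F - {j, l}) - (F - {i, j, k})" "indep (insert y (F - {i, j, k}))"
      using augment l(3) by blast
    have eq: "insert i (F - {i, j, k}) = F - {j, k}" "insert k (F - {i, j, k}) = F - {i, j}"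
      using inF ne ik(1) by auto
    from y(1) have "y = i \<or> y = k" by auto
    then show False using dep y(2) eq by metis
  qed
  define c where "c i = {j \<in> W. par i j}" for i
  have c_iff: "c i = c j \<longleftrightarrow> par i j" if "i \<in> W" "j \<in> W" for i j
  proof
    assume "c i = c j"
    moreover have "j \<in> c j" using that by (simp add: c_def par_def)
    ultimately show "par i j" by (auto simp: c_def)
  next
    assume p: "par i j"
    have "par i l \<longleftrightarrow> par j l" if "l \<in> W" for l
      using par_trans[OF \<open>i \<in> W\<close> \<open>j \<in> W\<close> that] par_trans[OF \<open>j \<in> W\<close> \<open>i \<in> W\<close> that] p par_sym[of i j]
      by auto
    then show "c i = c j" unfolding c_def by auto
  qed
  have "(\<Sum>i\<in>F. \<Sum>j\<in>F. if i \<noteq> j \<and> indep (F - {i, j}) then x i * x j else 0) =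
      (\<Sum>i\<in>W. \<Sum>j\<in>W. if i \<noteq> j \<and> indep (F - {i, j}) then x i * x j else 0)"
  proof (rule sum.mono_neutral_cong_right[OF fin(1)])
    show "W \<subseteq> F" by fact
    show "\<forall>i\<in>F - W. (\<Sum>j\<in>F. if i \<noteq> j \<and> indep (F - {i, j}) then x i * x j else 0) = 0"
      using JW by (intro ballI sum.neutral) (metis DiffD1 DiffD2)
    fix i assume i: "i \<in> W"
    show "(\<Sum>j\<in>F. if i \<noteq> j \<and> indep (F - {i, j}) then x i * x j else 0) =
        (\<Sum>j\<in>W. if i \<noteq> j \<and> indep (F - {i, j}) then x i * x j else 0)"
    proof (rule sum.mono_neutral_right[OF fin(1)])
      show "\<forall>j\<in>F - W. (if i \<noteq> j \<and> indep (F - {i, j}) then x i * x j else 0) = 0"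
        using i JW \<open>W \<subseteq> F\<close> by (metis DiffD1 DiffD2 subsetD)
    qed (rule \<open>W \<subseteq> F\<close>)
  qed
  \<comment> \<open>The diagonal belongs to the classes, so the same-class pairs are all that is
    missing from the full square.\<close>
  also have "\<dots> = (\<Sum>i\<in>W. \<Sum>j\<in>W. x i * x j - (if c i = c j then x i * x j else 0))"
    by (intro sum.cong refl) (simp add: c_iff par_def)
  also have "\<dots> = (\<Sum>i\<in>W. x i)\<^sup>2 - (\<Sum>i\<in>W. \<Sum>j\<in>W. if c i = c j then x i * x j else 0)"
    by (simp add: sum_subtractf power2_eq_square sum_product)
  also have "\<dots> \<le> 0" using L sum_same_class_nonneg[OF fin(2)] by simp
  finally show ?thesis .
qed

text \<open>If an independent \<open>p\<close>-set avoids both \<open>i\<close> and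
  \<open>j\<close>, any further point of \<open>F\<close> serves as \<open>w\<close>. Otherwise
  \<open>i \<in> B\<close> and \<open>j \<in> A\<close>, and augmenting \<open>A - {j}\<close> from
  \<open>B\<close> yields either such a set or \<open>insert i (A - {j})\<close>. In the latter case
  this set and \<open>A\<close> both avoid any \<open>w\<close> outside
  \<open>insert i A\<close>.\<close>

lemma common_avoiding_element:
  assumes F: "F \<subseteq> carrier" "p + 3 \<le> card F"
    and A: "indep A" "A \<subseteq> F - {i}" "card A = p" and B: "indep B" "B \<subseteq> F - {j}" "card B = p"
    and ij: "i \<in> F" "j \<in> F"
  obtains w A' B' where "w \<in> F" "w \<noteq> i" "w \<noteq> j" "indep A'" "A' \<subseteq> F - {i, w}" "card A' = p"
    "indep B'" "B' \<subseteq> F - {j, w}" "card B' = p"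
proof -
  note goal = that
  have fin: "finite F" "finite A" "finite B" using finite_subset[OF F(1) finite_carrier] A B indep_finite by auto
  have avoid: "\<exists>w\<in>F. w \<notin> X" if "finite X" "card X \<le> p + 2" for X
  proof (rule ccontr)
    assume "\<not> (\<exists>w\<in>F. w \<notin> X)"
    then have "F \<subseteq> X" by auto
    then have "card F \<le> card X" using that by (intro card_mono)
    then show False using that F by simp
  qed
  have both: thesis if D: "indep D" "D \<subseteq> F - {i, j}" "card D = p" for D
  proof -
    have "finite D" using D indep_finite by auto
    then have "card (D \<union> {i, j}) \<le> p + 2"
      using D(3) \<open>finite D\<close> by (simp add: card_insert_if)
    then obtain w where "w \<in> F" "w \<notin> D \<union> {i, j}" using avoid[of "D \<union> {i, j}"] \<open>finite D\<close> by auto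
    then show thesis using goal[of w D D] D by auto
  qed
  consider "i \<notin> B" | "j \<notin> A" | "i \<in> B" "j \<in> A" by blast
  then show thesis
  proof cases
    case 1 then show thesis using both[of B] B by auto
  next
    case 2 then show thesis using both[of A] A by auto
  next
    case 3
    have "i \<noteq> j" using 3 A by auto
    have cA: "card (A - {j}) = p - 1" "0 < p" using A fin 3 card_gt_0_iff by (auto simp: card_Diff_singleton)
    have "indep (A - {j})" using A(1) by (rule indep_subset) auto
    moreover have "card (A - {j}) < card B" using cA B by simp
    ultimately obtain x where x: "x \<in> B - (A - {j})" "indep (insert x (A - {j}))"
      using augment B(1) by blast
    then have xA: "x \<notin> A" "x \<noteq> j" "x \<in> F" using B 3 by auto
    have cx: "card (insert x (A - {j})) = p" using xA cA fin by simp
    show thesis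
    proof (cases "x = i")
      case False
      then show thesis using both[OF x(2) _ cx] xA A by auto
    next
      case True
      have "card (insert i A) \<le> p + 2" using fin A(3) by (simp add: card_insert_if)
      then obtain w where w: "w \<in> F" "w \<notin> insert i A"
        using avoid[of "insert i A"] fin by auto
      then have "w \<noteq> j" using 3 by auto
      show thesis
      proof (rule goal[of w A "insert x (A - {j})"])
        show "insert x (A - {j}) \<subseteq> F - {j, w}" using xA A w True by auto
      qed (use w A x cx \<open>w \<noteq> j\<close> in auto)
    qed
  qed
qed

end

section \<open>The Alexandrov--Fenchel inequality of a matroid\<close>

context matroid
begin

definition idx :: "'a option set" where
  "idx = insert None (Some ` carrier)"

text \<open>The factor \<open>fact\<close> comes from differentiating \<open>w\<^sub>0^|I|\<close>.\<close>

definition wt :: "'a option multiset \<Rightarrow> real" where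
  "wt s = (if \<exists>I. indep I \<and> s = config (card I) (carrier - I) then fact (count s None) else 0)"

lemma finite_idx: "finite idx"
  using finite_carrier by (simp add: idx_def)

lemma sum_idx: "(\<Sum>v\<in>idx. g v) = g None + (\<Sum>i\<in>carrier. g (Some i))"
  unfolding idx_def using finite_carrier by (subst sum.insert) (auto simp: sum.reindex)

lemma wt_nonneg: "0 \<le> wt s"
  by (simp add: wt_def)

lemma wt_config:
  assumes "S \<subseteq> carrier"
  shows "wt (config p S) = (if indep (carrier - S) \<and> p + card S = card carrier then fact p else 0)"
proof -
  have fin: "finite S" using assms finite_carrier by (rule finite_subset)
  have card: "card (carrier - S) + card S = card carrier"
    using assms finite_carrier card_Diff_subset[OF fin assms] card_mono[OF finite_carrier assms] by simp
  have "(\<exists>I. indep I \<and> config p S = config (card I) (carrier - I)) \<longleftrightarrow>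
      indep (carrier - S) \<and> p + card S = card carrier"
  proof
    assume "\<exists>I. indep I \<and> config p S = config (card I) (carrier - I)"
    then obtain I where I: "indep I" "config p S = config (card I) (carrier - I)" by blast
    have "p = card I" "S = carrier - I"
      using config_inject[OF fin _ I(2)] finite_carrier by auto
    moreover have "carrier - (carrier - I) = I" using indep_subset_carrier[OF I(1)] by auto
    ultimately show "indep (carrier - S) \<and> p + card S = card carrier" using I(1) card by simp
  next
    assume *: "indep (carrier - S) \<and> p + card S = card carrier"
    moreover have "carrier - (carrier - S) = S" using assms by auto
    moreover have "p = card (carrier - S)" using * card by simp
    ultimately show "\<exists>I. indep I \<and> config p S = config (card I) (carrier - I)"
      by (intro exI[of _ "carrier - S"]) simp
  qed
  then show ?thesis by (simp add: wt_def)
qed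

lemma wt_summand:
  assumes "wt (s + t) \<noteq> 0"
  obtains p S where "S \<subseteq> carrier" "s = config p S"
proof -
  obtain I where "s + t = config (card I) (carrier - I)" using assms by (auto simp: wt_def split: if_splits)
  moreover have "finite (carrier - I)" using finite_carrier by simp
  ultimately obtain q T where "T \<subseteq> carrier - I" "s = config q T" using config_summand by metis
  then show thesis using that[of T q] by auto
qed

text \<open>The polynomial is multiaffine in the variables of the ground set.\<close>

lemma wt_repeated:
  assumes "2 \<le> count s (Some x)"
  shows "wt s = 0"
proof (rule ccontr)
  assume "wt s \<noteq> 0"
  then have "wt (s + {#}) \<noteq> 0" by simp
  then obtain p S where S: "S \<subseteq> carrier" "s = config p S" by (rule wt_summand)
  then have "finite S" using finite_subset[OF _ finite_carrier] by blast
  then show False using assms S(2) by (simp split: if_splits)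
qed

text \<open>Differentiating along \<open>config p S\<close> leaves a quadratic form in
  \<open>None\<close> and the \<open>p + 2\<close> points of \<open>F\<close>. Its entries ask
  whether \<open>F\<close> without zero, one or two points is independent; the factorials come from
  the total number of derivatives in the variable \<open>None\<close>.\<close>

lemma local_form:
  assumes S: "S \<subseteq> carrier" and p: "p + card S + 2 = card carrier" and F: "F = carrier - S"
  shows "bil idx (\<lambda>u v. wt (add_mset u (add_mset v (config p S)))) f f =
    fact (p + 2) * (if indep F then (f None)\<^sup>2 else 0) +
    2 * fact (p + 1) * f None * (\<Sum>i\<in>F. if indep (F - {i}) then f (Some i) else 0) +
    fact p * (\<Sum>i\<in>F. \<Sum>j\<in>F. if i \<noteq> j \<and> indep (F - {i, j}) then f (Some i) * f (Some j) else 0)"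
proof -
  let ?A = "\<lambda>u v. wt (add_mset u (add_mset v (config p S)))"
  have fin: "finite S" using S finite_carrier by (rule finite_subset)
  have FC: "F \<subseteq> carrier" using F by auto
  have A00: "?A None None = (if indep F then fact (p + 2) else 0)"
    using wt_config[OF S, of "p + 2"] p by (simp add: F)
  have A0i: "?A None (Some i) = (if i \<in> F \<and> indep (F - {i}) then fact (p + 1) else 0)" if "i \<in> carrier" for i
  proof (cases "i \<in> F")
    case True
    then have "?A None (Some i) = wt (config (p + 1) (insert i S))" using fin F by simp
    also have "\<dots> = (if indep (carrier - insert i S) then fact (p + 1) else 0)"
      using wt_config[of "insert i S" "p + 1"] S fin True F p by auto
    also have "carrier - insert i S = F - {i}" using F by auto
    finally show ?thesis using True by simp
  next
    case False
    then have "i \<in> S" using that F by auto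
    then show ?thesis using False fin by (intro wt_repeated[where x = i, THEN trans]) auto
  qed
  have Ai0: "?A (Some i) None = ?A None (Some i)" for i by (simp only: add_mset_commute)
  have Aij: "?A (Some i) (Some j) = (if i \<in> F \<and> j \<in> F \<and> i \<noteq> j \<and> indep (F - {i, j}) then fact p else 0)"
    if "i \<in> carrier" "j \<in> carrier" for i j
  proof (cases "i \<in> F \<and> j \<in> F \<and> i \<noteq> j")
    case True
    then have "?A (Some i) (Some j) = wt (config p (insert i (insert j S)))" using fin F by simp
    also have "\<dots> = (if indep (carrier - insert i (insert j S)) then fact p else 0)"
      using wt_config[of "insert i (insert j S)" "p"] S fin True F p by auto
    also have "carrier - insert i (insert j S) = F - {i, j}" using F by auto
    finally show ?thesis using True by simp
  next
    case False
    then have "i \<in> S \<or> j \<in> S \<or> i = j" using that F by auto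
    then have "2 \<le> count (add_mset (Some i) (add_mset (Some j) (config p S))) (Some i) \<or>
        2 \<le> count (add_mset (Some i) (add_mset (Some j) (config p S))) (Some j)" using fin by auto
    then have "?A (Some i) (Some j) = 0" using wt_repeated by blast
    then show ?thesis using False by auto
  qed
  have restrict: "(\<Sum>i\<in>carrier. if i \<in> F then g i else 0) = (\<Sum>i\<in>F. g i)" for g :: "'a \<Rightarrow> real"
    using FC finite_carrier by (intro sum.mono_neutral_cong_right) auto
  have s1: "(\<Sum>i\<in>carrier. ?A None (Some i) * f (Some i)) =
      fact (p + 1) * (\<Sum>i\<in>F. if indep (F - {i}) then f (Some i) else 0)"
    unfolding sum_distrib_left restrict[symmetric] using A0i by (intro sum.cong) auto
  have s2: "(\<Sum>j\<in>carrier. ?A (Some i) (Some j) * f (Some j)) * f (Some i) =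
      (if i \<in> F then fact p * (\<Sum>j\<in>F. if i \<noteq> j \<and> indep (F - {i, j}) then f (Some i) * f (Some j) else 0) else 0)"
    if "i \<in> carrier" for i
  proof (cases "i \<in> F")
    case True
    then show ?thesis
      unfolding sum_distrib_left sum_distrib_right restrict[symmetric] using Aij[OF that]
      by (auto intro!: sum.cong)
  next
    case False
    then show ?thesis using Aij[OF that] by simp
  qed
  have "bil idx ?A f f = f None * (?A None None * f None + (\<Sum>i\<in>carrier. ?A None (Some i) * f (Some i))) +
      (\<Sum>i\<in>carrier. f (Some i) * (?A (Some i) None * f None + (\<Sum>j\<in>carrier. ?A (Some i) (Some j) * f (Some j))))"
    unfolding bil_rows sum_idx ..
  also have "(\<Sum>i\<in>carrier. f (Some i) * (?A (Some i) None * f None + (\<Sum>j\<in>carrier. ?A (Some i) (Some j) * f (Some j)))) =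
     (\<Sum>i\<in>carrier. ?A None (Some i) * f (Some i)) * f None +
     (\<Sum>i\<in>carrier. (\<Sum>j\<in>carrier. ?A (Some i) (Some j) * f (Some j)) * f (Some i))"
    unfolding Ai0 sum_distrib_right[of _ _ "f None"] sum.distrib[symmetric]
    by (intro sum.cong refl) (simp add: distrib_left mult_ac)
  also have "(\<Sum>i\<in>carrier. (\<Sum>j\<in>carrier. ?A (Some i) (Some j) * f (Some j)) * f (Some i)) =
    (\<Sum>i\<in>carrier. if i \<in> F then fact p * (\<Sum>j\<in>F. if i \<noteq> j \<and> indep (F - {i, j}) then f (Some i) * f (Some j) else 0) else 0)"
    by (rule sum.cong[OF refl s2])
  also have "\<dots> = fact p * (\<Sum>i\<in>F. \<Sum>j\<in>F. if i \<noteq> j \<and> indep (F - {i, j}) then f (Some i) * f (Some j) else 0)"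
    unfolding restrict sum_distrib_left[of "fact p" _ F, symmetric] ..
  finally show ?thesis unfolding s1 A00 by (simp add: power2_eq_square algebra_simps)
qed

text \<open>The form is zero unless \<open>s\<close> is a \<open>config\<close>. Otherwise the
  nullity of \<open>F\<close> is zero, one or at least two, and each case has its own hyperplane on
  which the form is nonpositive.\<close>

lemma local_hyperbolic:
  assumes "size s + 2 = card carrier"
  shows "hyperbolic idx (\<lambda>u v. wt (add_mset u (add_mset v s)))"
proof (cases "\<exists>p S. S \<subseteq> carrier \<and> s = config p S")
  case False
  have "wt (add_mset u (add_mset v s)) = 0" for u v
    using False wt_summand[of s "{#u, v#}"] by (fastforce simp: add_mset_commute)
  then show ?thesis by (simp add: hyperbolic_def bil_def)
next
  case True
  then obtain p S where S: "S \<subseteq> carrier" and s: "s = config p S" by blast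
  define F where "F = carrier - S"
  have finS: "finite S" using S finite_carrier by (rule finite_subset)
  have F: "F \<subseteq> carrier" "finite F" using finite_carrier by (auto simp: F_def)
  have p: "p + card S + 2 = card carrier" using assms s finS by simp
  have cardF: "card F = p + 2" unfolding F_def using card_Diff_subset[OF finS S] p by simp
  let ?B = "bil idx (\<lambda>u v. wt (add_mset u (add_mset v s)))"
  note form = local_form[OF S p F_def, folded s]
  \<comment> \<open>A functional on \<open>None\<close> and \<open>F\<close> is extended by 0 to the
    points of \<open>S\<close>.\<close>
  have hyp: "hyperbolic idx (\<lambda>u v. wt (add_mset u (add_mset v s)))"
    if a: "\<And>f. b * f None + (\<Sum>i\<in>F. a i * f (Some i)) = 0 \<Longrightarrow> ?B f f \<le> 0" for a :: "'a \<Rightarrow> real" and b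
  proof (rule hyperbolicI[where a = "\<lambda>v. case v of None \<Rightarrow> b | Some i \<Rightarrow> if i \<in> F then a i else 0"])
    show "wt (add_mset u (add_mset v s)) = wt (add_mset v (add_mset u s))" for u v
      by (simp only: add_mset_commute)
    show "0 \<le> wt (add_mset u (add_mset v s))" for u v by (rule wt_nonneg)
    fix f :: "'a option \<Rightarrow> real"
    assume "(\<Sum>v\<in>idx. (case v of None \<Rightarrow> b | Some i \<Rightarrow> if i \<in> F then a i else 0) * f v) = 0"
    moreover have "(\<Sum>i\<in>carrier. (if i \<in> F then a i else 0) * f (Some i)) = (\<Sum>i\<in>F. a i * f (Some i))"
      using F finite_carrier by (intro sum.mono_neutral_cong_right) auto
    ultimately show "?B f f \<le> 0" using a by (simp add: sum_idx)
  qed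
  consider "indep F" | "\<not> indep F" "\<exists>i\<in>F. indep (F - {i})" | "\<not> indep F" "\<forall>i\<in>F. \<not> indep (F - {i})" by blast
  then show ?thesis
  proof cases
    case 1
    show ?thesis
    \<comment> \<open>The functional is the row of \<open>None\<close> divided by
      \<open>fact (p + 1)\<close>. On its kernel the form is
      \<open>fact p * (?m * (f None)\<^sup>2 - ?Q)\<close>, nonpositive by Cauchy--Schwarz because
      \<open>card F = p + 2\<close>.\<close>
    proof (rule hyp[of "real (p + 2)" "\<lambda>_. 1"])
      fix f :: "'a option \<Rightarrow> real"
      assume l: "real (p + 2) * f None + (\<Sum>i\<in>F. 1 * f (Some i)) = 0"
      have sub: "indep (F - X)" for X using 1 by (rule indep_subset) auto
      let ?X = "\<Sum>i\<in>F. f (Some i)" and ?Q = "\<Sum>i\<in>F. (f (Some i))\<^sup>2" and ?m = "real (p + 2)"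
      have X: "?X = - ?m * f None" using l[unfolded mult_1_left] by linarith
      have "?X\<^sup>2 \<le> ?Q * real (card F)" by (rule sum_squared_le_sum_of_squares)
      then have "?m * (?m * (f None)\<^sup>2) \<le> ?m * ?Q"
        unfolding X cardF by (simp add: power2_eq_square algebra_simps)
      then have le: "?m * (f None)\<^sup>2 \<le> ?Q" by (rule mult_left_le_imp_le) simp_all
      have "?B f f = fact p * (?m * (?m - 1) * (f None)\<^sup>2 + 2 * (?m - 1) * f None * ?X + (?X\<^sup>2 - ?Q))"
        unfolding form double_sum_off_diagonal[OF F(2), symmetric]
        by (simp add: 1 sub fact_reduce algebra_simps)
      also have "\<dots> = fact p * (?m * (f None)\<^sup>2 - ?Q)"
        unfolding X by (simp add: power2_eq_square algebra_simps)
      also have "\<dots> \<le> 0" using le by (simp add: mult_nonneg_nonpos)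
      finally show "?B f f \<le> 0" .
    qed
  next
    case 2
    define C where "C = {i \<in> F. indep (F - {i})}"
    have CF: "C \<subseteq> F" "C \<noteq> {}" using 2 by (auto simp: C_def)
    have sC: "(\<Sum>i\<in>F. if indep (F - {i}) then g i else 0) = (\<Sum>i\<in>C. g i)" for g :: "'a \<Rightarrow> real"
      unfolding C_def using F by (intro sum.mono_neutral_cong_right) auto
    show ?thesis
    \<comment> \<open>Up to a factor the row of \<open>None\<close> is the indicator of the circuit,
      so this hyperplane also kills the mixed term with \<open>f None\<close>.\<close>
    proof (rule hyp[of 0 "\<lambda>i. if i \<in> C then 1 else 0"])
      fix f :: "'a option \<Rightarrow> real"
      assume "0 * f None + (\<Sum>i\<in>F. (if i \<in> C then 1 else 0) * f (Some i)) = 0"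
      moreover have "(\<Sum>i\<in>F. (if i \<in> C then 1 else 0) * f (Some i)) = (\<Sum>i\<in>C. f (Some i))"
        using F CF by (intro sum.mono_neutral_cong_right) auto
      ultimately have L: "(\<Sum>i\<in>C. f (Some i)) = 0" by simp
      show "?B f f \<le> 0"
        unfolding form sC L using nullity_one_form[OF F(1) 2(1) C_def CF(2) L] 2(1)
        by (simp add: mult_nonneg_nonpos)
    qed
  next
    case 3
    define W where "W = {i \<in> F. \<exists>j\<in>F. j \<noteq> i \<and> indep (F - {i, j})}"
    have WF: "W \<subseteq> F" by (auto simp: W_def)
    show ?thesis
    \<comment> \<open>All entries involving \<open>None\<close> vanish here; \<open>W\<close>
      consists of the points with a nonzero row.\<close>
    proof (rule hyp[of 0 "\<lambda>i. if i \<in> W then 1 else 0"])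
      fix f :: "'a option \<Rightarrow> real"
      assume "0 * f None + (\<Sum>i\<in>F. (if i \<in> W then 1 else 0) * f (Some i)) = 0"
      moreover have "(\<Sum>i\<in>F. (if i \<in> W then 1 else 0) * f (Some i)) = (\<Sum>i\<in>W. f (Some i))"
        using F WF by (intro sum.mono_neutral_cong_right) auto
      ultimately have L: "(\<Sum>i\<in>W. f (Some i)) = 0" by simp
      have "(\<Sum>i\<in>F. if indep (F - {i}) then f (Some i) else 0) = 0" using 3(2) by (intro sum.neutral) auto
      then show "?B f f \<le> 0"
        unfolding form using nullity_two_form[OF F(1) _ W_def L] 3 by (simp add: mult_nonneg_nonpos)
    qed
  qed
qed

text \<open>A completion exhibits an independent set disjoint from \<open>S\<close> with at least
  \<open>p\<close> elements, which can be shrunk to size \<open>p\<close>. Conversely, given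
  \<open>I\<close>, the elements of \<open>carrier - I - S\<close> complete the multiset without a
  further \<open>None\<close>.\<close>

lemma extendable_config:
  assumes S: "S \<subseteq> carrier"
  shows "extendable idx wt (card carrier) (config p S) \<longleftrightarrow>
    (\<exists>I. indep I \<and> I \<subseteq> carrier - S \<and> card I = p)"
proof
  assume "extendable idx wt (card carrier) (config p S)"
  then obtain t where "0 < wt (config p S + t)" by (auto simp: extendable_def)
  then obtain I where I: "indep I" "config p S + t = config (card I) (carrier - I)"
    by (auto simp: wt_def split: if_splits)
  obtain q T where T: "T \<subseteq> carrier - I" "config p S = config q T"
    by (rule config_summand[OF finite_Diff[OF finite_carrier] I(2)])
  have "finite T" using finite_subset[OF T(1)] finite_carrier by simp
  then have "S = T"
    using config_inject(2)[OF finite_subset[OF S finite_carrier] _ T(2)] by simp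
  have "count (config p S + t) None = card I" unfolding I(2) by simp
  then have "p \<le> card I" by simp
  then obtain J where J: "J \<subseteq> I" "card J = p" by (rule obtain_subset_with_card_n)
  have "J \<subseteq> carrier - S"
    using J(1) T(1) \<open>S = T\<close> indep_subset_carrier[OF I(1)] by auto
  then show "\<exists>I. indep I \<and> I \<subseteq> carrier - S \<and> card I = p"
    using indep_subset[OF I(1) J(1)] J(2) by auto
next
  assume "\<exists>I. indep I \<and> I \<subseteq> carrier - S \<and> card I = p"
  then obtain I where I: "indep I" "I \<subseteq> carrier - S" "card I = p" by blast
  let ?t = "config 0 (carrier - I - S)"
  have fin: "finite S" using S finite_carrier by (rule finite_subset)
  have Ic: "I \<subseteq> carrier" by (rule indep_subset_carrier[OF I(1)])
  have "config p S + ?t = config (card I) (carrier - I)"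
    using I S fin finite_carrier by (intro multiset_option_eqI) auto
  then have "0 < wt (config p S + ?t)" "size (config p S) + size ?t = card carrier"
  proof -
    assume eq: "config p S + ?t = config (card I) (carrier - I)"
    have "wt (config p S + ?t) \<noteq> 0" unfolding eq wt_def using I(1) by auto
    then show "0 < wt (config p S + ?t)" using wt_nonneg by (simp add: less_le)
    have "size (config p S + ?t) = size (config (card I) (carrier - I))" unfolding eq ..
    then show "size (config p S) + size ?t = card carrier"
      using card_Diff_subset[OF indep_finite[OF I(1)] Ic] card_mono[OF finite_carrier Ic] by simp
  qed
  moreover have "set_mset ?t \<subseteq> idx" unfolding config_def idx_def using finite_carrier by auto
  ultimately show "extendable idx wt (card carrier) (config p S)"
    unfolding extendable_def by blast
qed

lemma extendable_add_Some:
  assumes S: "S \<subseteq> carrier" and i: "i \<in> carrier"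
  shows "extendable idx wt (card carrier) (add_mset (Some i) (config p S)) \<longleftrightarrow>
    i \<notin> S \<and> (\<exists>I. indep I \<and> I \<subseteq> carrier - S - {i} \<and> card I = p)"
proof (cases "i \<in> S")
  case True
  have "finite S" using S finite_carrier by (rule finite_subset)
  then have "wt (add_mset (Some i) (config p S) + t) = 0" for t
    using True by (intro wt_repeated[of _ i]) simp
  then show ?thesis using True by (simp add: extendable_def)
next
  case False
  have "finite S" using S finite_carrier by (rule finite_subset)
  moreover have "carrier - insert i S = carrier - S - {i}" by auto
  ultimately show ?thesis using False extendable_config[of "insert i S" p] S i by simp
qed

text \<open>If \<open>F\<close> contains an independent set \<open>I\<close> of size
  \<open>p + 1\<close>, a point of \<open>F - I\<close> other than \<open>u\<close> and
  \<open>v\<close> is a common neighbour, as \<open>I\<close> or a \<open>p\<close>-subset of it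
  avoids all that is needed. When no such point exists, \<open>None\<close> is one. If there is no
  such \<open>I\<close>, \<open>common_avoiding_element\<close> applies.\<close>

lemma connected:
  assumes size: "size s + 3 \<le> card carrier" and uv: "u \<in> idx" "v \<in> idx"
    and ext: "extendable idx wt (card carrier) (add_mset u s)" "extendable idx wt (card carrier) (add_mset v s)"
  shows "\<exists>w\<in>idx. extendable idx wt (card carrier) (add_mset w (add_mset u s)) \<and>
    extendable idx wt (card carrier) (add_mset w (add_mset v s))"
proof -
  let ?ext = "extendable idx wt (card carrier)"
  obtain t where "0 < wt (add_mset u s + t)" using ext(1) by (auto simp: extendable_def)
  then have "wt (s + add_mset u t) \<noteq> 0" by simp
  then obtain p S where S: "S \<subseteq> carrier" and s: "s = config p S" by (rule wt_summand)
  define F where "F = carrier - S"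
  have finS: "finite S" using S finite_carrier by (rule finite_subset)
  have F: "F \<subseteq> carrier" "finite F" using finite_carrier by (auto simp: F_def)
  have cardF: "p + 3 \<le> card F" unfolding F_def using card_Diff_subset[OF finS S] size s finS by simp
  have e0: "?ext (add_mset None s) \<longleftrightarrow> (\<exists>I. indep I \<and> I \<subseteq> F \<and> card I = p + 1)"
    unfolding s F_def using extendable_config[OF S, of "p + 1"] by simp
  have ei: "?ext (add_mset (Some i) s) \<longleftrightarrow> i \<in> F \<and> (\<exists>I. indep I \<and> I \<subseteq> F - {i} \<and> card I = p)"
    if "i \<in> carrier" for i
    unfolding s F_def using extendable_add_Some[OF S that, of p] that by auto
  have e0i: "?ext (add_mset None (add_mset (Some i) s)) \<longleftrightarrow> (\<exists>I. indep I \<and> I \<subseteq> F - {i} \<and> card I = p + 1)"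
    if "i \<in> F" for i
    using extendable_add_Some[OF S, of i "p + 1"] that by (simp add: s F_def add_mset_commute[of None])
  have eij: "?ext (add_mset (Some j) (add_mset (Some i) s)) \<longleftrightarrow> (\<exists>I. indep I \<and> I \<subseteq> F - {i, j} \<and> card I = p)"
    if "i \<in> F" "j \<in> F" "i \<noteq> j" for i j
  proof -
    have "add_mset (Some i) s = config p (insert i S)" using that finS by (simp add: s F_def)
    moreover have "carrier - insert i S - {j} = F - {i, j}" by (auto simp: F_def)
    ultimately show ?thesis using extendable_add_Some[of "insert i S" j p] S that by (simp add: F_def)
  qed
  show ?thesis
  proof (cases "\<exists>I. indep I \<and> I \<subseteq> F \<and> card I = p + 1")
    case True
    then obtain I where I: "indep I" "I \<subseteq> F" "card I = p + 1" by blast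
    have finI: "finite I" using I(1) by (rule indep_finite)
    show ?thesis
    proof (cases "\<exists>w\<in>F - I. Some w \<noteq> u \<and> Some w \<noteq> v")
      case True
      then obtain w where w: "w \<in> F" "w \<notin> I" "Some w \<noteq> u" "Some w \<noteq> v" by blast
      have "?ext (add_mset (Some w) (add_mset u s))" if "u \<in> idx" "?ext (add_mset u s)" "Some w \<noteq> u" for u
      proof (cases u)
        case None
        have "I \<subseteq> F - {w}" using I w by auto
        then show ?thesis using e0i[OF w(1)] I None by (auto simp: add_mset_commute)
      next
        case (Some i)
        then have i: "i \<in> F" "i \<noteq> w" using that ei[of i] by (auto simp: idx_def)
        have "p \<le> card (I - {i})" using I finI by (simp add: card_Diff_singleton_if)
        then obtain J where J: "J \<subseteq> I - {i}" "card J = p" by (rule obtain_subset_with_card_n)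
        then have "indep J" using indep_subset[OF I(1)] by auto
        moreover have "J \<subseteq> F - {i, w}" using J w I by auto
        ultimately show ?thesis using eij[OF i(1) w(1) i(2)] J Some by auto
      qed
      then show ?thesis using uv ext w F by (intro bexI[of _ "Some w"]) (auto simp: idx_def)
    next
      case False
      \<comment> \<open>At least two points lie outside \<open>I\<close>, and all of them are among
        \<open>u\<close> and \<open>v\<close>. Hence \<open>I\<close> avoids both, and
        \<open>None\<close> can be added to each.\<close>
      have "card (F - I) \<ge> 2" using card_Diff_subset[OF finI I(2)] I cardF by simp
      then obtain a b where ab: "a \<in> F - I" "b \<in> F - I" "a \<noteq> b"
        by (metis card_le_Suc0_iff_eq F(2) finite_Diff not_less_eq_eq numeral_2_eq_2)
      have "?ext (add_mset None (add_mset (Some a) s))" if "a \<in> F - I" for a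
        using e0i[of a] that I by auto
      moreover have "u \<in> Some ` (F - I)" "v \<in> Some ` (F - I)"
      proof -
        have "Some a = u \<or> Some a = v" "Some b = u \<or> Some b = v" using False ab by blast+
        then have "u = Some a \<and> v = Some b \<or> u = Some b \<and> v = Some a" using ab(3) by auto
        then show "u \<in> Some ` (F - I)" "v \<in> Some ` (F - I)" using ab by auto
      qed
      ultimately show ?thesis by (intro bexI[of _ None]) (auto simp: idx_def)
    qed
  next
    case False
    \<comment> \<open>Without an independent set of size \<open>p + 1\<close> in \<open>F\<close>,
      \<open>None\<close> does not extend \<open>s\<close>, so \<open>u\<close> and \<open>v\<close>
      are both points of the ground set.\<close>
    then obtain i j where ij: "u = Some i" "v = Some j" "i \<in> carrier" "j \<in> carrier"
      using e0 ext uv unfolding idx_def by auto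
    obtain A B where AB: "i \<in> F" "indep A" "A \<subseteq> F - {i}" "card A = p"
        "j \<in> F" "indep B" "B \<subseteq> F - {j}" "card B = p"
      using ei ext ij by metis
    obtain w A' B' where w: "w \<in> F" "w \<noteq> i" "w \<noteq> j" "indep A'" "A' \<subseteq> F - {i, w}" "card A' = p"
        "indep B'" "B' \<subseteq> F - {j, w}" "card B' = p"
      using common_avoiding_element[OF F(1) cardF AB(2-4,6-8,1,5)] by blast
    have "?ext (add_mset (Some w) (add_mset (Some i) s))" "?ext (add_mset (Some w) (add_mset (Some j) s))"
      using eij[OF AB(1) w(1)] eij[OF AB(5) w(1)] w by auto
    then show ?thesis using ij w F by (intro bexI[of _ "Some w"]) (auto simp: idx_def)
  qed
qed

theorem wt_alexandrov_fenchel: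
  assumes "\<And>c v. c \<in> set cs \<Longrightarrow> v \<in> idx \<Longrightarrow> 0 \<le> c v" "\<And>v. v \<in> idx \<Longrightarrow> 0 \<le> g v"
    and "length cs + 2 = card carrier"
  shows "mix idx wt (f # f # cs) {#} * mix idx wt (g # g # cs) {#} \<le> (mix idx wt (f # g # cs) {#})\<^sup>2"
  by (rule mix_alexandrov_fenchel[OF finite_idx wt_nonneg local_hyperbolic connected]) (use assms in auto)

end

section \<open>Counting disjoint pairs\<close>

context matroid
begin

section \<open>Evaluating the polarization in the homogenizing and all-ones directions\<close>

abbreviation zero_dir :: "'a option \<Rightarrow> real" where
  "zero_dir \<equiv> indicator {None}"

abbreviation all_dir :: "'a option \<Rightarrow> real" where
  "all_dir \<equiv> indicator (range Some)"

lemma mix_zero_dir: "mix idx wt (replicate k zero_dir @ cs) (config p S) = mix idx wt cs (config (p + k) S)"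
  by (induction k arbitrary: p) (simp_all add: sum_idx)

lemma mix_eq_0: "(\<And>t. wt (s + t) = 0) \<Longrightarrow> mix idx wt cs s = 0"
proof (induction cs arbitrary: s)
  case Nil
  from Nil[of "{#}"] show ?case by simp
next
  case (Cons c cs)
  have "mix idx wt cs (add_mset v s) = 0" for v
    using Cons.prems[of "add_mset v t" for t] by (intro Cons.IH) simp
  then show ?case by simp
qed

lemma finite_indep_sets: "finite {I. indep I \<and> P I}"
  by (rule finite_subset[of _ "Pow carrier"]) (use indep_subset_carrier finite_carrier in auto)

text \<open>The weight contributes \<open>fact k\<close>. For each \<open>I\<close>, the
  \<open>q\<close> all-ones slots list the complement of \<open>I\<close> in
  \<open>carrier - S\<close> in every order, which contributes \<open>fact q\<close>.\<close>

lemma mix_all_dir: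
  assumes "S \<subseteq> carrier" "k + q + card S = card carrier"
  shows "mix idx wt (replicate q all_dir) (config k S) =
    fact k * fact q * real (card {I. indep I \<and> I \<subseteq> carrier - S \<and> card I = k})"
  using assms
proof (induction q arbitrary: S)
  case 0
  have finS: "finite S" using 0(1) finite_carrier by (rule finite_subset)
  have cR: "card (carrier - S) = k" using card_Diff_subset[OF finS 0(1)] 0(2) by simp
  have "I = carrier - S" if "I \<subseteq> carrier - S" "card I = k" for I
    using that cR finite_carrier by (intro card_subset_eq) auto
  then have "{I. indep I \<and> I \<subseteq> carrier - S \<and> card I = k} = (if indep (carrier - S) then {carrier - S} else {})"
    using cR by auto
  then show ?case using wt_config[OF 0(1), of k] 0(2) by simp
next
  case (Suc q)
  let ?R = "carrier - S"
  define J where "J = {I. indep I \<and> I \<subseteq> ?R \<and> card I = k}"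
  have finS: "finite S" using Suc.prems(1) finite_carrier by (rule finite_subset)
  have finR: "finite ?R" using finite_carrier by simp
  have finJ: "finite J" unfolding J_def by (rule finite_indep_sets)
  have cR: "card ?R = k + Suc q" using card_Diff_subset[OF finS Suc.prems(1)] Suc.prems(2) by simp
  have step: "mix idx wt (replicate q all_dir) (add_mset (Some i) (config k S)) =
      (if i \<in> ?R then fact k * fact q * real (card {I \<in> J. i \<notin> I}) else 0)" if "i \<in> carrier" for i
  proof (cases "i \<in> ?R")
    case True
    have "{I. indep I \<and> I \<subseteq> carrier - insert i S \<and> card I = k} = {I \<in> J. i \<notin> I}"
      unfolding J_def by auto
    then show ?thesis using Suc.IH[of "insert i S"] Suc.prems True finS by simp
  next
    case False
    then have "i \<in> S" using that by auto
    then have "wt (add_mset (Some i) (config k S) + t) = 0" for t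
      using finS by (intro wt_repeated[of _ i]) simp
    then have "mix idx wt (replicate q all_dir) (add_mset (Some i) (config k S)) = 0" by (rule mix_eq_0)
    then show ?thesis using False by (simp only: if_False)
  qed
  have "mix idx wt (replicate (Suc q) all_dir) (config k S) =
      (\<Sum>i\<in>carrier. if i \<in> ?R then fact k * fact q * real (card {I \<in> J. i \<notin> I}) else 0)"
    using step by (simp add: sum_idx)
  also have "\<dots> = (\<Sum>i\<in>?R. fact k * fact q * real (card {I \<in> J. i \<notin> I}))"
    using finite_carrier by (intro sum.mono_neutral_cong_right) auto
  also have "\<dots> = fact k * fact q * real (\<Sum>i\<in>?R. card {I \<in> J. i \<notin> I})"
    by (simp add: sum_distrib_left)
  \<comment> \<open>Double counting of pairs with \<open>i \<notin> I\<close>: each \<open>I\<close>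
    misses \<open>Suc q\<close> points of \<open>?R\<close>, which raises \<open>fact q\<close> to
    \<open>fact (Suc q)\<close>.\<close>
  also have "(\<Sum>i\<in>?R. card {I \<in> J. i \<notin> I}) = (\<Sum>I\<in>J. card {i \<in> ?R. i \<notin> I})"
    by (rule sum_multicount_gen[OF finR finJ]) auto
  also have "\<dots> = (\<Sum>I\<in>J. Suc q)"
  proof (rule sum.cong[OF refl])
    fix I assume "I \<in> J"
    then have I: "I \<subseteq> ?R" "card I = k" by (auto simp: J_def)
    have "{i \<in> ?R. i \<notin> I} = ?R - I" by auto
    then show "card {i \<in> ?R. i \<notin> I} = Suc q"
      using card_Diff_subset[OF finite_subset[OF I(1) finR] I(1)] cR I(2) by simp
  qed
  also have "\<dots> = card J * Suc q" by simp
  finally show ?case unfolding J_def[symmetric] by (simp add: algebra_simps)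
qed

end

section \<open>Direct sums of matroids and splittings of two copies\<close>

definition sum_indep :: "('a set \<Rightarrow> bool) \<Rightarrow> ('b set \<Rightarrow> bool) \<Rightarrow> ('a + 'b) set \<Rightarrow> bool" where
  "sum_indep indep1 indep2 J \<longleftrightarrow> indep1 (Inl -` J) \<and> indep2 (Inr -` J)"

lemma Plus_vimage: "Inl -` J <+> Inr -` J = J"
proof (rule set_eqI)
  fix x show "x \<in> Inl -` J <+> Inr -` J \<longleftrightarrow> x \<in> J" by (cases x) auto
qed

lemma vimage_Plus [simp]: "Inl -` (A <+> B) = A" "Inr -` (A <+> B) = B"
  by auto

text \<open>Cardinality is additive over the summands, so a larger independent set is larger in one
  of them and augmentation takes place there.\<close>

lemma matroid_sum:
  assumes "matroid E indep1" "matroid F indep2"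
  shows "matroid (E <+> F) (sum_indep indep1 indep2)"
proof -
  interpret M1: matroid E indep1 by fact
  interpret M2: matroid F indep2 by fact
  show ?thesis
  proof
    show "finite (E <+> F)" using M1.finite_carrier M2.finite_carrier by simp
    show "X \<subseteq> E <+> F" if "sum_indep indep1 indep2 X" for X
    proof -
      have "Inl -` X \<subseteq> E" "Inr -` X \<subseteq> F"
        using that M1.indep_subset_carrier M2.indep_subset_carrier by (auto simp: sum_indep_def)
      then have "Inl -` X <+> Inr -` X \<subseteq> E <+> F" by auto
      then show ?thesis by (simp add: Plus_vimage)
    qed
    show "sum_indep indep1 indep2 {}" by (simp add: sum_indep_def M1.indep_empty M2.indep_empty)
    show "sum_indep indep1 indep2 Y" if "sum_indep indep1 indep2 X" "Y \<subseteq> X" for X Y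
      using that M1.indep_subset[of "Inl -` X" "Inl -` Y"] M2.indep_subset[of "Inr -` X" "Inr -` Y"]
      by (auto simp: sum_indep_def)
    show "\<exists>x\<in>Y - X. sum_indep indep1 indep2 (insert x X)"
      if X: "sum_indep indep1 indep2 X" and Y: "sum_indep indep1 indep2 Y" and less: "card X < card Y" for X Y
    proof -
      have card: "card Z = card (Inl -` Z) + card (Inr -` Z)" if "sum_indep indep1 indep2 Z" for Z
        using that M1.indep_finite M2.indep_finite card_Plus[of "Inl -` Z" "Inr -` Z"]
        by (simp add: sum_indep_def Plus_vimage)
      consider "card (Inl -` X) < card (Inl -` Y)" | "card (Inr -` X) < card (Inr -` Y)"
        using less card[OF X] card[OF Y] by linarith
      then show ?thesis
      proof cases
        case 1
        then obtain x where x: "x \<in> Inl -` Y - Inl -` X" "indep1 (insert x (Inl -` X))"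
          using M1.augment[of "Inl -` X" "Inl -` Y"] X Y by (auto simp: sum_indep_def)
        have "Inl -` insert (Inl x) X = insert x (Inl -` X)" "Inr -` insert (Inl x) X = Inr -` X" by auto
        then show ?thesis using x X by (intro bexI[of _ "Inl x"]) (auto simp: sum_indep_def)
      next
        case 2
        then obtain x where x: "x \<in> Inr -` Y - Inr -` X" "indep2 (insert x (Inr -` X))"
          using M2.augment[of "Inr -` X" "Inr -` Y"] X Y by (auto simp: sum_indep_def)
        have "Inr -` insert (Inr x) X = insert x (Inr -` X)" "Inl -` insert (Inr x) X = Inl -` X" by auto
        then show ?thesis using x X by (intro bexI[of _ "Inr x"]) (auto simp: sum_indep_def)
      qed
    qed
  qed
qed

lemma card_between:
  assumes "finite B" "A \<subseteq> B"
  shows "card {Y. A \<subseteq> Y \<and> Y \<subseteq> B} = 2 ^ (card B - card A)"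
proof -
  have "bij_betw (\<lambda>Y. Y - A) {Y. A \<subseteq> Y \<and> Y \<subseteq> B} (Pow (B - A))"
    by (rule bij_betwI[where g = "\<lambda>Z. Z \<union> A"]) (use assms(2) in auto)
  then have "card {Y. A \<subseteq> Y \<and> Y \<subseteq> B} = card (Pow (B - A))" by (rule bij_betw_same_card)
  then show ?thesis using assms finite_subset[OF assms(2,1)] by (simp add: card_Pow card_Diff_subset)
qed

text \<open>The points of \<open>Y\<close> lose their left copy and the others their right copy, so
  the left part must avoid \<open>Y\<close> and the right part must lie in it.\<close>

lemma Plus_subset_Diff_Plus_iff:
  assumes "A \<subseteq> E" "B \<subseteq> E" "Y \<subseteq> E"
  shows "A <+> B \<subseteq> (E <+> E) - (Y <+> (E - Y)) \<longleftrightarrow> B \<subseteq> Y \<and> Y \<subseteq> E - A"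
proof
  assume sub: "A <+> B \<subseteq> (E <+> E) - (Y <+> (E - Y))"
  have "a \<notin> Y" if "a \<in> A" for a using that sub by blast
  moreover have "b \<in> Y" if "b \<in> B" for b using that sub assms(2) by blast
  ultimately show "B \<subseteq> Y \<and> Y \<subseteq> E - A" using assms(3) by blast
qed (use assms in auto)

section \<open>Disjoint pairs in the direct sum of two matroids\<close>

locale matroid_pair =
  M1: matroid E indep1 + M2: matroid E indep2
  for E :: "'a set" and indep1 indep2
begin

sublocale D: matroid "E <+> E" "sum_indep indep1 indep2"
  by (rule matroid_sum) unfold_locales

text \<open>Differentiating along this direction bars one of the two copies of \<open>x\<close> from
  the independent set, with a sum over the choice of copy.\<close>

definition pair_dir :: "'a \<Rightarrow> ('a + 'a) option \<Rightarrow> real" where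
  "pair_dir x = indicator {Some (Inl x), Some (Inr x)}"

abbreviation "V \<equiv> D.idx"
abbreviation "\<phi> \<equiv> D.wt"

lemma mix_pair_dir_Cons:
  assumes "x \<in> E" "finite S" "Inl x \<notin> S" "Inr x \<notin> S"
  shows "mix V \<phi> (pair_dir x # cs) (config p S) =
    mix V \<phi> cs (config p (insert (Inl x) S)) + mix V \<phi> cs (config p (insert (Inr x) S))"
proof -
  have "mix V \<phi> (pair_dir x # cs) (config p S) =
      (\<Sum>v\<in>{Some (Inl x), Some (Inr x)}. mix V \<phi> cs (add_mset v (config p S)))"
    unfolding mix.simps
  proof (rule sum.mono_neutral_cong_right[OF D.finite_idx])
    show "{Some (Inl x), Some (Inr x)} \<subseteq> V" using assms(1) by (auto simp: D.idx_def)
  qed (auto simp: pair_dir_def)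
  then show ?thesis using assms by simp
qed

text \<open>Expanding by linearity picks one copy for each point; \<open>Y\<close> records the
  points whose left copy is picked.\<close>

lemma mix_pair_dirs:
  assumes "distinct xs" "set xs \<subseteq> E" "finite S" "\<And>x. x \<in> set xs \<Longrightarrow> Inl x \<notin> S \<and> Inr x \<notin> S"
  shows "mix V \<phi> (map pair_dir xs @ cs) (config p S) =
    (\<Sum>Y\<in>Pow (set xs). mix V \<phi> cs (config p (S \<union> (Y <+> (set xs - Y)))))"
  using assms
proof (induction xs arbitrary: S)
  case (Cons x xs)
  let ?g = "\<lambda>Y. mix V \<phi> cs (config p (S \<union> (Y <+> (set (x # xs) - Y))))"
  have x: "x \<notin> set xs" "x \<in> E" "Inl x \<notin> S" "Inr x \<notin> S" using Cons.prems by auto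
  have "mix V \<phi> (map pair_dir (x # xs) @ cs) (config p S) =
    mix V \<phi> (map pair_dir xs @ cs) (config p (insert (Inl x) S)) +
    mix V \<phi> (map pair_dir xs @ cs) (config p (insert (Inr x) S))"
    using mix_pair_dir_Cons[OF x(2) Cons.prems(3) x(3,4)] by simp
  also have "mix V \<phi> (map pair_dir xs @ cs) (config p (insert (Inl x) S)) =
      (\<Sum>Y\<in>Pow (set xs). mix V \<phi> cs (config p (insert (Inl x) S \<union> (Y <+> (set xs - Y)))))"
    using Cons.prems x by (intro Cons.IH) auto
  also have "\<dots> = (\<Sum>Y\<in>Pow (set xs). ?g (insert x Y))"
  proof (rule sum.cong[OF refl])
    fix Y assume "Y \<in> Pow (set xs)"
    then have "insert (Inl x) S \<union> (Y <+> (set xs - Y)) = S \<union> (insert x Y <+> (set (x # xs) - insert x Y))"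
      using x(1) by auto
    then show "mix V \<phi> cs (config p (insert (Inl x) S \<union> (Y <+> (set xs - Y)))) = ?g (insert x Y)"
      by simp
  qed
  also have "mix V \<phi> (map pair_dir xs @ cs) (config p (insert (Inr x) S)) =
      (\<Sum>Y\<in>Pow (set xs). mix V \<phi> cs (config p (insert (Inr x) S \<union> (Y <+> (set xs - Y)))))"
    using Cons.prems x by (intro Cons.IH) auto
  also have "\<dots> = (\<Sum>Y\<in>Pow (set xs). ?g Y)"
  proof (rule sum.cong[OF refl])
    fix Y assume "Y \<in> Pow (set xs)"
    then have "insert (Inr x) S \<union> (Y <+> (set xs - Y)) = S \<union> (Y <+> (set (x # xs) - Y))"
      using x(1) by auto
    then show "mix V \<phi> cs (config p (insert (Inr x) S \<union> (Y <+> (set xs - Y)))) = ?g Y"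
      by simp
  qed
  \<comment> \<open>The subsets of the longer list are split by whether they contain
    \<open>x\<close>.\<close>
  also have "(\<Sum>Y\<in>Pow (set xs). ?g (insert x Y)) + (\<Sum>Y\<in>Pow (set xs). ?g Y) = (\<Sum>Y\<in>Pow (set (x # xs)). ?g Y)"
  proof -
    have inj: "inj_on (insert x) (Pow (set xs))"
    proof (rule inj_onI)
      fix A B assume "A \<in> Pow (set xs)" "B \<in> Pow (set xs)" "insert x A = insert x B"
      then show "A = B" using x(1) by (metis PowD insert_ident subsetD)
    qed
    have "Pow (set (x # xs)) = Pow (set xs) \<union> insert x ` Pow (set xs)" by (simp add: Pow_insert)
    moreover have "Pow (set xs) \<inter> insert x ` Pow (set xs) = {}" using x(1) by auto
    ultimately have "(\<Sum>Y\<in>Pow (set (x # xs)). ?g Y) = (\<Sum>Y\<in>Pow (set xs). ?g Y) + (\<Sum>Y\<in>insert x ` Pow (set xs). ?g Y)"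
      by (simp only: sum.union_disjoint finite_Pow_iff finite_imageI finite_set)
    also have "(\<Sum>Y\<in>insert x ` Pow (set xs). ?g Y) = (\<Sum>Y\<in>Pow (set xs). ?g (insert x Y))"
      using sum.reindex[OF inj, of ?g] by (simp only: o_def)
    finally show ?thesis by (simp only: add.commute)
  qed
  finally show ?case .
qed (simp add: Plus_def)

text \<open>After exchanging the sums, each \<open>J\<close> with left part \<open>A\<close> and
  right part \<open>B\<close> is counted once for every \<open>Y\<close> between \<open>B\<close>
  and \<open>E - A\<close>. There are \<open>2 ^ (card E - k)\<close> of these if \<open>A\<close>
  and \<open>B\<close> are disjoint, and none otherwise.\<close>

lemma sum_card_split_sets:
  assumes "k \<le> card E"
  shows "(\<Sum>Y\<in>Pow E. card {J. sum_indep indep1 indep2 J \<and> J \<subseteq> (E <+> E) - (Y <+> (E - Y)) \<and> card J = k}) =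
    2 ^ (card E - k) * num_disjoint_indep_pairs indep1 indep2 k"
proof -
  define \<J> where "\<J> = {J. sum_indep indep1 indep2 J \<and> card J = k}"
  define \<D> where "\<D> = {J \<in> \<J>. Inl -` J \<inter> Inr -` J = {}}"
  have finJ: "finite \<J>" unfolding \<J>_def by (rule D.finite_indep_sets)
  have finE: "finite E" by (rule M1.finite_carrier)
  have sub: "J \<subseteq> (E <+> E) - (Y <+> (E - Y)) \<longleftrightarrow> Inr -` J \<subseteq> Y \<and> Y \<subseteq> E - Inl -` J"
    if "J \<in> \<J>" "Y \<subseteq> E" for J Y
  proof -
    have "Inl -` J \<subseteq> E" "Inr -` J \<subseteq> E"
      using that(1) M1.indep_subset_carrier M2.indep_subset_carrier
      by (auto simp: \<J>_def sum_indep_def)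
    from Plus_subset_Diff_Plus_iff[OF this that(2)] show ?thesis unfolding Plus_vimage .
  qed
  have "(\<Sum>Y\<in>Pow E. card {J. sum_indep indep1 indep2 J \<and> J \<subseteq> (E <+> E) - (Y <+> (E - Y)) \<and> card J = k}) =
      (\<Sum>Y\<in>Pow E. card {J \<in> \<J>. Inr -` J \<subseteq> Y \<and> Y \<subseteq> E - Inl -` J})"
  proof (rule sum.cong[OF refl])
    fix Y assume "Y \<in> Pow E"
    then have Y: "Y \<subseteq> E" by simp
    have "sum_indep indep1 indep2 J \<and> J \<subseteq> (E <+> E) - (Y <+> (E - Y)) \<and> card J = k \<longleftrightarrow>
        J \<in> \<J> \<and> Inr -` J \<subseteq> Y \<and> Y \<subseteq> E - Inl -` J" for J
    proof (cases "J \<in> \<J>")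
      case True
      then show ?thesis unfolding sub[OF True Y] by (simp add: \<J>_def)
    qed (unfold \<J>_def, blast)
    then show "card {J. sum_indep indep1 indep2 J \<and> J \<subseteq> (E <+> E) - (Y <+> (E - Y)) \<and> card J = k} =
      card {J \<in> \<J>. Inr -` J \<subseteq> Y \<and> Y \<subseteq> E - Inl -` J}" by (simp only:)
  qed
  also have "\<dots> = (\<Sum>J\<in>\<J>. card {Y \<in> Pow E. Inr -` J \<subseteq> Y \<and> Y \<subseteq> E - Inl -` J})"
    by (rule sum_multicount_gen[OF _ finJ]) (use finE in auto)
  also have "\<dots> = (\<Sum>J\<in>\<J>. if J \<in> \<D> then 2 ^ (card E - k) else 0)"
  proof (rule sum.cong[OF refl])
    fix J assume J: "J \<in> \<J>"
    have sE: "Inl -` J \<subseteq> E" "Inr -` J \<subseteq> E"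
      using J M1.indep_subset_carrier M2.indep_subset_carrier by (auto simp: \<J>_def sum_indep_def)
    have fin: "finite (Inl -` J)" "finite (Inr -` J)" using finite_subset[OF sE(1) finE] finite_subset[OF sE(2) finE] by auto
    have cJ: "card (Inl -` J) + card (Inr -` J) = k"
      using J fin card_Plus[of "Inl -` J" "Inr -` J"] by (simp add: \<J>_def Plus_vimage)
    have eq: "{Y \<in> Pow E. Inr -` J \<subseteq> Y \<and> Y \<subseteq> E - Inl -` J} = {Y. Inr -` J \<subseteq> Y \<and> Y \<subseteq> E - Inl -` J}" by auto
    show "card {Y \<in> Pow E. Inr -` J \<subseteq> Y \<and> Y \<subseteq> E - Inl -` J} = (if J \<in> \<D> then 2 ^ (card E - k) else 0)"
    proof (cases "J \<in> \<D>")
      case True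
      then have "Inr -` J \<subseteq> E - Inl -` J" using sE by (auto simp: \<D>_def)
      then have "card {Y. Inr -` J \<subseteq> Y \<and> Y \<subseteq> E - Inl -` J} = 2 ^ (card (E - Inl -` J) - card (Inr -` J))"
        using finE by (intro card_between) auto
      also have "card (E - Inl -` J) - card (Inr -` J) = card E - k"
        using card_Diff_subset[OF fin(1) sE(1)] cJ by simp
      finally show ?thesis using True eq by simp
    next
      case False
      then have "\<not> Inr -` J \<subseteq> E - Inl -` J" using J by (auto simp: \<D>_def)
      then have none: "{Y. Inr -` J \<subseteq> Y \<and> Y \<subseteq> E - Inl -` J} = {}" by blast
      show ?thesis using False by (simp only: eq none card.empty if_False)
    qed
  qed
  also have "\<dots> = 2 ^ (card E - k) * card \<D>"
  proof -
    have "(\<Sum>J\<in>\<J>. if J \<in> \<D> then 2 ^ (card E - k) else 0 :: nat) = (\<Sum>J\<in>\<D>. 2 ^ (card E - k))"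
      using finJ by (intro sum.mono_neutral_cong_right) (auto simp: \<D>_def)
    then show ?thesis by simp
  qed
  \<comment> \<open>Disjointness of the parts makes the disjoint sum and the union equally
    large.\<close>
  also have "card \<D> = card (disjoint_indep_pairs indep1 indep2 k)"
  proof (rule bij_betw_same_card)
    have card: "card (A <+> B) = card (A \<union> B)" if "indep1 A" "indep2 B" "A \<inter> B = {}" for A B
      using that M1.indep_finite M2.indep_finite by (simp add: card_Plus card_Un_disjoint)
    show "bij_betw (\<lambda>J. (Inl -` J, Inr -` J)) \<D> (disjoint_indep_pairs indep1 indep2 k)"
    proof (rule bij_betwI[where g = "\<lambda>(A, B). A <+> B"])
      show "(\<lambda>J. (Inl -` J, Inr -` J)) \<in> \<D> \<rightarrow> disjoint_indep_pairs indep1 indep2 k"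
        using card[of "Inl -` J" "Inr -` J" for J]
        by (auto simp: \<D>_def \<J>_def disjoint_indep_pairs_def sum_indep_def Plus_vimage)
      show "(\<lambda>(A, B). A <+> B) \<in> disjoint_indep_pairs indep1 indep2 k \<rightarrow> \<D>"
        using card by (auto simp: \<D>_def \<J>_def disjoint_indep_pairs_def sum_indep_def)
    qed (auto simp: Plus_vimage)
  qed
  finally show ?thesis unfolding num_disjoint_indep_pairs_def .
qed

text \<open>The pair directions choose a splitting \<open>Y\<close>, the \<open>k\<close>
  homogenizing directions set the size of the independent sets, and the all-ones directions count
  those that avoid the copies barred by \<open>Y\<close>. Summing over \<open>Y\<close> counts every
  disjoint pair \<open>2 ^ q\<close> times.\<close>

lemma mix_num_disjoint_indep_pairs:
  assumes "set xs = E" "distinct xs" "k + q = card E"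
  shows "mix V \<phi> (map pair_dir xs @ replicate k D.zero_dir @ replicate q D.all_dir) {#} =
    fact k * fact q * 2 ^ q * real (num_disjoint_indep_pairs indep1 indep2 k)"
proof -
  have finE: "finite E" by (rule M1.finite_carrier)
  have "mix V \<phi> (map pair_dir xs @ replicate k D.zero_dir @ replicate q D.all_dir) {#} =
      mix V \<phi> (map pair_dir xs @ replicate k D.zero_dir @ replicate q D.all_dir) (config 0 {})"
    by (simp add: config_def)
  also have "\<dots> = (\<Sum>Y\<in>Pow E. mix V \<phi> (replicate q D.all_dir) (config k (Y <+> (E - Y))))"
    using assms by (subst mix_pair_dirs) (simp_all add: D.mix_zero_dir)
  also have "\<dots> = (\<Sum>Y\<in>Pow E. fact k * fact q *
      real (card {J. sum_indep indep1 indep2 J \<and> J \<subseteq> (E <+> E) - (Y <+> (E - Y)) \<and> card J = k}))"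
  proof (rule sum.cong[OF refl])
    fix Y assume "Y \<in> Pow E"
    then have Y: "Y \<subseteq> E" "finite Y" using finE finite_subset[of Y E] by auto
    \<comment> \<open>Every splitting uses \<open>card E\<close> of the \<open>2 * card E\<close>
      points, which leaves exactly \<open>k + q\<close> slots.\<close>
    have "card (Y <+> (E - Y)) = card E"
      using Y finE card_mono[OF finE Y(1)] by (simp add: card_Plus card_Diff_subset)
    then show "mix V \<phi> (replicate q D.all_dir) (config k (Y <+> (E - Y))) = fact k * fact q *
      real (card {J. sum_indep indep1 indep2 J \<and> J \<subseteq> (E <+> E) - (Y <+> (E - Y)) \<and> card J = k})"
      using Y assms(3) finE by (intro D.mix_all_dir) (auto simp: card_Plus)
  qed
  also have "\<dots> = fact k * fact q * real (\<Sum>Y\<in>Pow E.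
      card {J. sum_indep indep1 indep2 J \<and> J \<subseteq> (E <+> E) - (Y <+> (E - Y)) \<and> card J = k})"
    by (simp add: sum_distrib_left)
  also have "\<dots> = fact k * fact q * (2 ^ q * real (num_disjoint_indep_pairs indep1 indep2 k))"
    using assms(3) by (subst sum_card_split_sets) auto
  finally show ?thesis by simp
qed

lemma num_disjoint_indep_pairs_log_concave:
  fixes k :: nat
  defines "H \<equiv> num_disjoint_indep_pairs indep1 indep2" and "n \<equiv> card E"
  assumes "k + 2 \<le> n"
  shows "(real (H k) / real (n choose k)) * (real (H (k + 2)) / real (n choose (k + 2)))
    \<le> (real (H (k + 1)) / real (n choose (k + 1)))\<^sup>2"
proof -
  obtain xs where xs: "set xs = E" "distinct xs"
    using finite_distinct_list[OF M1.finite_carrier] by blast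
  then have len: "length xs = n" by (metis n_def distinct_card)
  \<comment> \<open>Of the \<open>n\<close> slots beside the pair directions, two are kept free for
    the directions that vary.\<close>
  define q where "q = n - k - 2"
  have n: "n = k + q + 2" using assms(3) by (simp add: q_def)
  define cs where "cs = map pair_dir xs @ replicate k D.zero_dir @ replicate q D.all_dir"
  define m where "m f g = mix V \<phi> (f # g # cs) {#}" for f g
  define a where "a j = real (H j) / real (n choose j)" for j
  \<comment> \<open>Since \<open>fact j * fact l\<close> is \<open>fact n\<close> divided by
    \<open>n choose j\<close>, the normalized count appears with a factor that depends on
    \<open>j\<close> only through a power of 2.\<close>
  have mixed_value: "mix V \<phi> ds {#} = fact n * 2 ^ l * a j"
    if "mset ds = mset (map pair_dir xs @ replicate j D.zero_dir @ replicate l D.all_dir)" "j + l = n" for ds j l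
  proof -
    have "mix V \<phi> ds {#} = fact j * fact l * 2 ^ l * real (H j)"
      unfolding mix_perm[OF that(1)] H_def using that(2) by (intro mix_num_disjoint_indep_pairs xs) (simp add: n_def)
    moreover have "real (n choose j) = fact n / (fact j * fact l)"
      using binomial_fact[of j n, where 'a = real] that(2) by auto
    ultimately show ?thesis by (simp add: a_def)
  qed
  have "m D.zero_dir D.zero_dir * m D.all_dir D.all_dir \<le> (m D.zero_dir D.all_dir)\<^sup>2"
    unfolding m_def
  proof (rule D.wt_alexandrov_fenchel)
    show "0 \<le> c v" if "c \<in> set cs" for c v
      using that by (auto simp: cs_def pair_dir_def)
    show "length cs + 2 = card (E <+> E)"
      using M1.finite_carrier n len by (simp add: cs_def card_Plus n_def)
  qed simp
  moreover have "m D.zero_dir D.zero_dir = fact n * 2 ^ q * a (k + 2)"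
    unfolding m_def by (rule mixed_value) (simp_all add: cs_def n)
  moreover have "m D.zero_dir D.all_dir = fact n * 2 ^ (q + 1) * a (k + 1)"
    unfolding m_def by (rule mixed_value) (simp_all add: cs_def n)
  moreover have "m D.all_dir D.all_dir = fact n * 2 ^ (q + 2) * a k"
    unfolding m_def by (rule mixed_value) (simp_all add: cs_def n)
  \<comment> \<open>The outer powers of 2 multiply to
    \<open>2 ^ q * 2 ^ (q + 2) = (2 ^ (q + 1))\<^sup>2\<close>, so both sides share one positive
    factor.\<close>
  ultimately have "(fact n * 2 ^ (q + 1))\<^sup>2 * (a k * a (k + 2)) \<le> (fact n * 2 ^ (q + 1))\<^sup>2 * (a (k + 1))\<^sup>2"
    by (simp add: power2_eq_square mult_ac)
  then have "a k * a (k + 2) \<le> (a (k + 1))\<^sup>2"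
    by (rule mult_left_le_imp_le) simp
  then show ?thesis unfolding a_def .
qed

end

theorem corollary3:
  fixes E :: "'a set"
    and indep1 indep2 :: "'a set \<Rightarrow> bool"
    and n k :: nat
    and H :: "nat \<Rightarrow> nat"
  defines "H \<equiv> num_disjoint_indep_pairs indep1 indep2"
  assumes "matroid E indep1"
    and "matroid E indep2"
    and "card E = n"
    and "k + 2 \<le> n"
  shows "(real (H k) / real (n choose k)) * (real (H (k + 2)) / real (n choose (k + 2)))
    \<le> (real (H (k + 1)) / real (n choose (k + 1)))\<^sup>2"
proof -
  interpret matroid_pair E indep1 indep2
    using assms(2,3) by (rule matroid_pair.intro)
  show ?thesis
    using num_disjoint_indep_pairs_log_concave[of k] assms(4,5) by (simp add: H_def)
qed

end
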